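(* Let $\Gamma$ be a groupoid and let $R$ be a $\Gamma$-graded ring. The following assertions hold: (1) If $R$ is right strongly $\Gamma_0$-artinian, then $\mathrm{rad}^{\mathrm{gr}}(R)$ is nilpotent and $R$ is right strongly $\Gamma_0$-noetherian. (2) If $R$ is right gr-artinian, then $\mathrm{rad}^{\mathrm{gr}}(R)$ is nilpotent and $R$ is right gr-noetherian.
   Context: A groupoid $\Gamma$ is the set of morphisms of a small category in which all morphisms are invertible; $\Gamma_0\subseteq\Gamma$ is the set of identity morphisms; $d(\gamma)=\gamma^{-1}\gamma$, $r(\gamma)=\gamma\gamma^{-1}$; the product $\gamma\delta$ is defined iff $d(\gamma)=r(\delta)$. Rings are associative, not necessarily unital. A $\Gamma$-graded ring is a ring $R=\bigoplus_{\gamma\in\Gamma}R_\gamma$ (additive subgroups) with $R_\gamma R_\delta\subseteq R_{\gamma\delta}$ if $d(\gamma)=r(\delta)$ and $R_\gamma R_\delta=0$ otherwise; it is always assumed object unital: for each $e\in\Gamma_0$ the ring $R_e$ has an identity $1_e$ (possibly $0$) with $1_{r(\gamma)}a=a=a1_{d(\gamma)}$ for all $a\in R_\gamma$, $\gamma\in\Gamma$. A one- or two-sided ideal $U$ of $R$ is graded if $U=\bigoplus_\gamma (U\cap R_\gamma)$. For a graded right ideal $U$ and $e\in\Gamma_0$, $U(e):=1_eU$. $R$ is right gr-artinian (resp. right gr-noetherian) if it has no infinite strictly decreasing (resp. increasing) chain of graded right ideals. $R$ is right strongly $\Gamma_0$-artinian (resp. right strongly $\Gamma_0$-noetherian) if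 there is no infinite strictly decreasing (resp. increasing) chain $\{U_i\}_{i\ge1}$ of graded right ideals of $R$ such that for all $e\in\Gamma_0$ and $i\ge 1$: $U_i(e)=U_{i+1}(e)$ implies $U_i(e)=U_{i+l}(e)$ for all $l\ge1$. $\mathrm{rad}^{\mathrm{gr}}(R)$, the graded Jacobson radical, is the intersection of all gr-maximal graded right ideals (those maximal among proper graded right ideals); it is a graded two-sided ideal. An ideal $U$ is nilpotent if $U^n=0$ for some positive integer $n$. *)

theory Defs
  imports Main HOL.Hull
begin

text \<open>Arrows-only presentation of a small category: an object is identified with its identity
  morphism, and \<open>d g\<close>, \<open>r g\<close> are the identities at the source and the target of \<open>g\<close>.
  The composite \<open>g \<cdot> h\<close> is only meaningful when \<open>d g = r h\<close>.\<close>

locale small_category =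
  fixes \<Gamma> :: "'g set"
    and mlt :: "'g \<Rightarrow> 'g \<Rightarrow> 'g" (infixl "\<cdot>" 70)
    and d :: "'g \<Rightarrow> 'g"
    and r :: "'g \<Rightarrow> 'g"
  assumes d_closed: "g \<in> \<Gamma> \<Longrightarrow> d g \<in> \<Gamma>"
    and r_closed: "g \<in> \<Gamma> \<Longrightarrow> r g \<in> \<Gamma>"
    and d_d: "g \<in> \<Gamma> \<Longrightarrow> d (d g) = d g"
    and r_d: "g \<in> \<Gamma> \<Longrightarrow> r (d g) = d g"
    and d_r: "g \<in> \<Gamma> \<Longrightarrow> d (r g) = r g"
    and r_r: "g \<in> \<Gamma> \<Longrightarrow> r (r g) = r g"
    and mlt_closed: "g \<in> \<Gamma> \<Longrightarrow> h \<in> \<Gamma> \<Longrightarrow> d g = r h \<Longrightarrow> g \<cdot> h \<in> \<Gamma>"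
    and d_mlt: "g \<in> \<Gamma> \<Longrightarrow> h \<in> \<Gamma> \<Longrightarrow> d g = r h \<Longrightarrow> d (g \<cdot> h) = d h"
    and r_mlt: "g \<in> \<Gamma> \<Longrightarrow> h \<in> \<Gamma> \<Longrightarrow> d g = r h \<Longrightarrow> r (g \<cdot> h) = r g"
    and mlt_assoc: "g \<in> \<Gamma> \<Longrightarrow> h \<in> \<Gamma> \<Longrightarrow> k \<in> \<Gamma> \<Longrightarrow> d g = r h \<Longrightarrow> d h = r k
      \<Longrightarrow> (g \<cdot> h) \<cdot> k = g \<cdot> (h \<cdot> k)"
    and r_mlt_left: "g \<in> \<Gamma> \<Longrightarrow> r g \<cdot> g = g"
    and mlt_d_right: "g \<in> \<Gamma> \<Longrightarrow> g \<cdot> d g = g"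

locale groupoid = small_category +
  assumes invertible: "g \<in> \<Gamma> \<Longrightarrow>
    \<exists>h\<in>\<Gamma>. d h = r g \<and> r h = d g \<and> h \<cdot> g = d g \<and> g \<cdot> h = r g"

text \<open>The set \<open>\<Gamma>\<^sub>0\<close> of identity morphisms; every identity \<open>e\<close> satisfies \<open>e = d e\<close>.\<close>

definition identities :: "'g set \<Rightarrow> ('g \<Rightarrow> 'g) \<Rightarrow> 'g set" where
  "identities \<Gamma> d = d ` \<Gamma>"

text \<open>Rings are types of class \<^class>\<open>ring\<close>, which are associative but need not have a unit.\<close>

definition add_subgroup :: "'a::ab_group_add set \<Rightarrow> bool" where
  "add_subgroup H \<longleftrightarrow> 0 \<in> H \<and> (\<forall>x\<in>H. \<forall>y\<in>H. x + y \<in> H) \<and> (\<forall>x\<in>H. - x \<in> H)"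

text \<open>The external direct sum: finitely supported families, extended by \<open>0\<close> outside \<open>I\<close>.\<close>

definition fin_supp_families :: "'i set \<Rightarrow> ('i \<Rightarrow> 'a::ab_group_add set) \<Rightarrow> ('i \<Rightarrow> 'a) set" where
  "fin_supp_families I A =
    {f. (\<forall>i\<in>I. f i \<in> A i) \<and> (\<forall>i. i \<notin> I \<longrightarrow> f i = 0) \<and> finite {i. f i \<noteq> 0}}"

definition is_direct_sum :: "'i set \<Rightarrow> ('i \<Rightarrow> 'a::ab_group_add set) \<Rightarrow> 'a set \<Rightarrow> bool" where
  "is_direct_sum I A U \<longleftrightarrow> (\<forall>i\<in>I. add_subgroup (A i)) \<and>
    bij_betw (\<lambda>f. \<Sum>i | f i \<noteq> 0. f i) (fin_supp_families I A) U"

text \<open>\<open>R g\<close> is the homogeneous component of degree \<open>g\<close> of the ring \<^term>\<open>UNIV :: 'a set\<close>.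
  The element \<open>one e\<close> is the identity \<open>1\<^sub>e\<close> of \<open>R e\<close>; it is determined by \<open>R\<close> for every
  identity morphism \<open>e\<close>. Taking \<open>g = e\<close> in the last two axioms says that it is an identity of \<open>R e\<close>.\<close>

locale graded_ring = groupoid \<Gamma> mlt d r
  for \<Gamma> :: "'g set" and mlt :: "'g \<Rightarrow> 'g \<Rightarrow> 'g" (infixl "\<cdot>" 70)
    and d :: "'g \<Rightarrow> 'g" and r :: "'g \<Rightarrow> 'g" +
  fixes R :: "'g \<Rightarrow> 'a::ring set" and one :: "'g \<Rightarrow> 'a"
  assumes direct_sum: "is_direct_sum \<Gamma> R UNIV"
    and mult_composable: "g \<in> \<Gamma> \<Longrightarrow> h \<in> \<Gamma> \<Longrightarrow> d g = r h \<Longrightarrow> a \<in> R g \<Longrightarrow> b \<in> R h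
      \<Longrightarrow> a * b \<in> R (g \<cdot> h)"
    and mult_not_composable: "g \<in> \<Gamma> \<Longrightarrow> h \<in> \<Gamma> \<Longrightarrow> d g \<noteq> r h \<Longrightarrow> a \<in> R g \<Longrightarrow> b \<in> R h
      \<Longrightarrow> a * b = 0"
    and one_in: "e \<in> identities \<Gamma> d \<Longrightarrow> one e \<in> R e"
    and one_left: "g \<in> \<Gamma> \<Longrightarrow> a \<in> R g \<Longrightarrow> one (r g) * a = a"
    and one_right: "g \<in> \<Gamma> \<Longrightarrow> a \<in> R g \<Longrightarrow> a * one (d g) = a"

definition right_ideal :: "'a::ring set \<Rightarrow> bool" where
  "right_ideal U \<longleftrightarrow> add_subgroup U \<and> (\<forall>u\<in>U. \<forall>x. u * x \<in> U)"

definition graded_right_ideal :: "'g set \<Rightarrow> ('g \<Rightarrow> 'a::ring set) \<Rightarrow> 'a set \<Rightarrow> bool" where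
  "graded_right_ideal \<Gamma> R U \<longleftrightarrow> right_ideal U \<and> is_direct_sum \<Gamma> (\<lambda>g. U \<inter> R g) U"

text \<open>\<open>U(e) = 1\<^sub>e U\<close>\<close>

definition ideal_at :: "('g \<Rightarrow> 'a::ring) \<Rightarrow> 'a set \<Rightarrow> 'g \<Rightarrow> 'a set" where
  "ideal_at one U e = (\<lambda>u. one e * u) ` U"

definition right_gr_artinian :: "'g set \<Rightarrow> ('g \<Rightarrow> 'a::ring set) \<Rightarrow> bool" where
  "right_gr_artinian \<Gamma> R \<longleftrightarrow>
    \<not> (\<exists>U::nat \<Rightarrow> 'a set. (\<forall>i. graded_right_ideal \<Gamma> R (U i)) \<and> (\<forall>i. U (Suc i) \<subset> U i))"

definition right_gr_noetherian :: "'g set \<Rightarrow> ('g \<Rightarrow> 'a::ring set) \<Rightarrow> bool" where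
  "right_gr_noetherian \<Gamma> R \<longleftrightarrow>
    \<not> (\<exists>U::nat \<Rightarrow> 'a set. (\<forall>i. graded_right_ideal \<Gamma> R (U i)) \<and> (\<forall>i. U i \<subset> U (Suc i)))"

text \<open>A chain such that, for every \<open>e \<in> E\<close>, the chain of the \<open>U\<^sub>i(e)\<close> is constant from its
  first repetition onwards. Chains are indexed from \<open>0\<close>.\<close>

definition stops_at_repetition ::
    "'g set \<Rightarrow> ('g \<Rightarrow> 'a::ring) \<Rightarrow> (nat \<Rightarrow> 'a set) \<Rightarrow> bool" where
  "stops_at_repetition E one U \<longleftrightarrow> (\<forall>e\<in>E. \<forall>i.
    ideal_at one (U i) e = ideal_at one (U (Suc i)) e \<longrightarrow>
    (\<forall>l\<ge>1. ideal_at one (U i) e = ideal_at one (U (i + l)) e))"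

definition right_strongly_artinian ::
    "'g set \<Rightarrow> ('g \<Rightarrow> 'g) \<Rightarrow> ('g \<Rightarrow> 'a::ring set) \<Rightarrow> ('g \<Rightarrow> 'a) \<Rightarrow> bool" where
  "right_strongly_artinian \<Gamma> d R one \<longleftrightarrow>
    \<not> (\<exists>U::nat \<Rightarrow> 'a set. (\<forall>i. graded_right_ideal \<Gamma> R (U i)) \<and> (\<forall>i. U (Suc i) \<subset> U i)
      \<and> stops_at_repetition (identities \<Gamma> d) one U)"

definition right_strongly_noetherian ::
    "'g set \<Rightarrow> ('g \<Rightarrow> 'g) \<Rightarrow> ('g \<Rightarrow> 'a::ring set) \<Rightarrow> ('g \<Rightarrow> 'a) \<Rightarrow> bool" where
  "right_strongly_noetherian \<Gamma> d R one \<longleftrightarrow>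
    \<not> (\<exists>U::nat \<Rightarrow> 'a set. (\<forall>i. graded_right_ideal \<Gamma> R (U i)) \<and> (\<forall>i. U i \<subset> U (Suc i))
      \<and> stops_at_repetition (identities \<Gamma> d) one U)"

definition gr_maximal_right_ideal :: "'g set \<Rightarrow> ('g \<Rightarrow> 'a::ring set) \<Rightarrow> 'a set \<Rightarrow> bool" where
  "gr_maximal_right_ideal \<Gamma> R M \<longleftrightarrow> graded_right_ideal \<Gamma> R M \<and> M \<noteq> UNIV \<and>
    (\<forall>N. graded_right_ideal \<Gamma> R N \<and> N \<noteq> UNIV \<and> M \<subseteq> N \<longrightarrow> N = M)"

text \<open>If there is no gr-maximal graded right ideal, the intersection is the whole ring.\<close>

definition gr_rad :: "'g set \<Rightarrow> ('g \<Rightarrow> 'a::ring set) \<Rightarrow> 'a set" where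
  "gr_rad \<Gamma> R = \<Inter> {M. gr_maximal_right_ideal \<Gamma> R M}"

definition ideal_mult :: "'a::ring set \<Rightarrow> 'a set \<Rightarrow> 'a set" where
  "ideal_mult U V = add_subgroup hull {u * v | u v. u \<in> U \<and> v \<in> V}"

text \<open>The value at exponent \<open>0\<close> is a mere convention. The case split is needed because
  \<open>R U = U\<close> may fail when the ring has no unit.\<close>

primrec ideal_power :: "'a::ring set \<Rightarrow> nat \<Rightarrow> 'a set" where
  "ideal_power U 0 = UNIV"
| "ideal_power U (Suc n) = (if n = 0 then U else ideal_mult (ideal_power U n) U)"

definition nilpotent_ideal :: "'a::ring set \<Rightarrow> bool" where
  "nilpotent_ideal U \<longleftrightarrow> (\<exists>n\<ge>1. ideal_power U n = {0})"

end

theory Submission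
  imports Defs "HOL-Library.Set_Algebras"
begin

text \<open>Write \<open>J\<close> for the graded radical. A strictly decreasing chain inside a single \<open>1\<^sub>e R\<close> is
  forbidden, and so is \<open>J \<supset> J\<^sup>2 \<supset> \<dots>\<close>, as \<open>1\<^sub>e J\<^sup>k = 1\<^sub>e J\<^sup>k\<^sup>+\<^sup>1\<close> persists for all larger
  exponents. Hence some power \<open>I = J\<^sup>n\<close> satisfies \<open>I = I J\<close>, and the usual argument with a minimal
  \<open>T \<subseteq> 1\<^sub>e R\<close> such that \<open>T I \<noteq> 0\<close> gives \<open>I = 0\<close>. Next, each \<open>1\<^sub>e R\<close> satisfies the ascending chain
  condition: for a minimal counterexample \<open>W\<close>, the nonzero \<open>W / W J\<close> is semisimple, so \<open>W\<close> has a
  maximal subideal, which is not a counterexample, and neither is \<open>W\<close>. Finally, in an infinite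
  ascending chain \<open>U\<close> the index at which \<open>1\<^sub>e U\<^sub>i\<close> stabilizes is finite for every \<open>e\<close> but
  unbounded in \<open>e\<close>, and this yields a forbidden descending chain.\<close>

section \<open>Additive subgroups and products of ideals\<close>

lemma add_subgroup_zero: "add_subgroup H \<Longrightarrow> 0 \<in> H"
  by (simp add: add_subgroup_def)

lemma add_subgroup_add: "add_subgroup H \<Longrightarrow> x \<in> H \<Longrightarrow> y \<in> H \<Longrightarrow> x + y \<in> H"
  by (simp add: add_subgroup_def)

lemma add_subgroup_uminus: "add_subgroup H \<Longrightarrow> x \<in> H \<Longrightarrow> - x \<in> H"
  by (simp add: add_subgroup_def)

lemma add_subgroup_diff: "add_subgroup H \<Longrightarrow> x \<in> H \<Longrightarrow> y \<in> H \<Longrightarrow> x - y \<in> H"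
  by (metis add_subgroup_add add_subgroup_uminus diff_conv_add_uminus)

lemma add_subgroup_sum: "add_subgroup H \<Longrightarrow> (\<And>i. i \<in> I \<Longrightarrow> f i \<in> H) \<Longrightarrow> sum f I \<in> H"
  by (induction I rule: infinite_finite_induct) (auto simp: add_subgroup_zero add_subgroup_add)

lemma additive_zero:
  fixes f :: "'a :: ab_group_add \<Rightarrow> 'b :: ab_group_add"
  assumes "\<And>x y. f (x + y) = f x + f y"
  shows "f 0 = 0"
  using assms[of 0 0] by simp

lemma additive_uminus:
  fixes f :: "'a :: ab_group_add \<Rightarrow> 'b :: ab_group_add"
  assumes "\<And>x y. f (x + y) = f x + f y"
  shows "f (- x) = - f x"
proof -
  have "f x + f (- x) = f (x + - x)"
    by (rule assms[symmetric])
  also have "\<dots> = 0"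
    using additive_zero[of f] assms by simp
  finally have "f x + f (- x) = 0" .
  then show ?thesis
    by (rule minus_unique[symmetric])
qed

text \<open>Together with \<open>ideal_mult_least\<close> this reduces a claim about all of
  \<open>ideal_mult U V\<close> to the generators \<open>u * v\<close>; it is applied to
  multiplication by a fixed element and to passage to a component.\<close>

lemma add_subgroup_vimage:
  assumes "add_subgroup H" and "\<And>x y. f (x + y) = f x + f y"
  shows "add_subgroup {x. f x \<in> H}"
  using assms(1) by (simp add: add_subgroup_def assms(2) additive_zero[of f, OF assms(2)]
      additive_uminus[of f, OF assms(2)])

lemma add_subgroup_image:
  assumes "add_subgroup H" and "\<And>x y. f (x + y) = f x + f y"
  shows "add_subgroup (f ` H)"
  using assms(1) unfolding add_subgroup_def
  by (force simp: assms(2)[symmetric] additive_uminus[of f, OF assms(2), symmetric]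
      intro: rev_image_eqI additive_zero[of f, OF assms(2), symmetric])

lemma add_subgroup_Int: "add_subgroup A \<Longrightarrow> add_subgroup B \<Longrightarrow> add_subgroup (A \<inter> B)"
  by (simp add: add_subgroup_def)

lemma add_subgroup_plus:
  assumes A: "add_subgroup A" and B: "add_subgroup B"
  shows "add_subgroup (A + B)"
  unfolding add_subgroup_def
proof (intro conjI ballI)
  show "0 \<in> A + B"
    using set_plus_intro[OF add_subgroup_zero[OF A] add_subgroup_zero[OF B]] by simp
next
  fix x y assume "x \<in> A + B" "y \<in> A + B"
  then obtain a b a' b' where ab: "a \<in> A" "b \<in> B" "a' \<in> A" "b' \<in> B"
    and [simp]: "x = a + b" "y = a' + b'"
    by (metis set_plus_elim)
  have "(a + a') + (b + b') \<in> A + B"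
    using ab by (intro set_plus_intro add_subgroup_add A B)
  then show "x + y \<in> A + B"
    by (simp add: algebra_simps)
next
  fix x assume "x \<in> A + B"
  then obtain a b where ab: "a \<in> A" "b \<in> B" and [simp]: "x = a + b"
    by (metis set_plus_elim)
  have "- a + - b \<in> A + B"
    using ab by (intro set_plus_intro add_subgroup_uminus A B)
  then show "- x \<in> A + B"
    by simp
qed

lemma subset_plus_left: "add_subgroup B \<Longrightarrow> A \<subseteq> A + B"
  using set_plus_intro[OF _ add_subgroup_zero, of _ A B] by auto

lemma subset_plus_right: "add_subgroup A \<Longrightarrow> B \<subseteq> A + B"
  using set_plus_intro[OF add_subgroup_zero, of A _ B] by auto

lemma plus_least: "add_subgroup C \<Longrightarrow> A \<subseteq> C \<Longrightarrow> B \<subseteq> C \<Longrightarrow> A + B \<subseteq> C"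
  by (auto elim!: set_plus_elim simp: add_subgroup_add subset_iff)

lemma right_ideal_subgroup: "right_ideal U \<Longrightarrow> add_subgroup U"
  by (simp add: right_ideal_def)

lemma right_ideal_mult: "right_ideal U \<Longrightarrow> u \<in> U \<Longrightarrow> u * x \<in> U"
  by (simp add: right_ideal_def)

lemma right_ideal_plus:
  assumes A: "right_ideal A" and B: "right_ideal B"
  shows "right_ideal (A + B)"
  unfolding right_ideal_def
proof (intro conjI ballI allI)
  show "add_subgroup (A + B)"
    using A B by (intro add_subgroup_plus right_ideal_subgroup)
  fix u x assume "u \<in> A + B"
  then obtain a b where "a \<in> A" "b \<in> B" and [simp]: "u = a + b"
    by (metis set_plus_elim)
  then have "a * x + b * x \<in> A + B"
    using A B by (intro set_plus_intro right_ideal_mult)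
  then show "u * x \<in> A + B"
    by (simp add: algebra_simps)
qed

lemma add_subgroup_hull: "add_subgroup (add_subgroup hull S)"
  by (rule hull_in) (auto simp: add_subgroup_def)

lemma ideal_mult_subgroup: "add_subgroup (ideal_mult U V)"
  unfolding ideal_mult_def by (rule add_subgroup_hull)

lemma ideal_multI: "u \<in> U \<Longrightarrow> v \<in> V \<Longrightarrow> u * v \<in> ideal_mult U V"
  unfolding ideal_mult_def by (rule hull_inc) blast

lemma ideal_mult_least:
  "add_subgroup H \<Longrightarrow> (\<And>u v. u \<in> U \<Longrightarrow> v \<in> V \<Longrightarrow> u * v \<in> H) \<Longrightarrow> ideal_mult U V \<subseteq> H"
  unfolding ideal_mult_def by (rule hull_minimal) auto

lemma ideal_mult_assoc: "ideal_mult (ideal_mult A B) C = ideal_mult A (ideal_mult B C)"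
proof (intro equalityI ideal_mult_least ideal_mult_subgroup)
  fix x c assume x: "x \<in> ideal_mult A B" and c: "c \<in> C"
  have "ideal_mult A B \<subseteq> {x. x * c \<in> ideal_mult A (ideal_mult B C)}"
    by (intro ideal_mult_least add_subgroup_vimage ideal_mult_subgroup)
       (auto simp: distrib_right mult.assoc intro!: ideal_multI c)
  then show "x * c \<in> ideal_mult A (ideal_mult B C)"
    using x by blast
next
  fix a x assume a: "a \<in> A" and x: "x \<in> ideal_mult B C"
  have "ideal_mult B C \<subseteq> {x. a * x \<in> ideal_mult (ideal_mult A B) C}"
    by (intro ideal_mult_least add_subgroup_vimage ideal_mult_subgroup)
       (auto simp: distrib_left mult.assoc[symmetric] intro!: ideal_multI a)
  then show "a * x \<in> ideal_mult (ideal_mult A B) C"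
    using x by blast
qed

lemma right_ideal_ideal_mult: "right_ideal V \<Longrightarrow> right_ideal (ideal_mult U V)"
  unfolding right_ideal_def
proof (intro conjI ballI allI ideal_mult_subgroup)
  fix u x assume V: "add_subgroup V \<and> (\<forall>u\<in>V. \<forall>x. u * x \<in> V)" and u: "u \<in> ideal_mult U V"
  have "ideal_mult U V \<subseteq> {u. u * x \<in> ideal_mult U V}"
    using V by (intro ideal_mult_least add_subgroup_vimage ideal_mult_subgroup)
       (auto simp: distrib_right mult.assoc intro!: ideal_multI)
  then show "u * x \<in> ideal_mult U V"
    using u by blast
qed

text \<open>Used twice: to make a stable power of the radical idempotent, and as a Nakayama argument
  once a power of the radical vanishes.\<close>

lemma ideal_mult_power_stable:
  assumes "ideal_mult W J = W" and "n \<ge> 1"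
  shows "ideal_mult W (ideal_power J n) = W"
  using assms(2)
proof (induction n rule: nat_induct_at_least)
  case base
  then show ?case using assms(1) by simp
next
  case (Suc n)
  then show ?case
    using assms(1) by (simp add: ideal_mult_assoc[symmetric])
qed

section \<open>Homogeneous components and graded right ideals\<close>

context graded_ring
begin

abbreviation gri :: "'a set \<Rightarrow> bool" where
  "gri \<equiv> graded_right_ideal \<Gamma> R"

abbreviation J :: "'a set" where
  "J \<equiv> gr_rad \<Gamma> R"

definition component :: "'a \<Rightarrow> 'g \<Rightarrow> 'a" where
  "component = inv_into (fin_supp_families \<Gamma> R) (\<lambda>f. \<Sum>g | f g \<noteq> 0. f g)"

lemma R_subgroup: "g \<in> \<Gamma> \<Longrightarrow> add_subgroup (R g)"
  using direct_sum by (simp add: is_direct_sum_def)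

lemma families_bij: "bij_betw (\<lambda>f. \<Sum>g | f g \<noteq> 0. f g) (fin_supp_families \<Gamma> R) UNIV"
  using direct_sum by (simp add: is_direct_sum_def)

lemma component_family: "component x \<in> fin_supp_families \<Gamma> R"
  unfolding component_def by (rule inv_into_into) (simp add: families_bij[unfolded bij_betw_def])

lemma component_in: "g \<in> \<Gamma> \<Longrightarrow> component x g \<in> R g"
  using component_family by (simp add: fin_supp_families_def)

lemma component_outside: "g \<notin> \<Gamma> \<Longrightarrow> component x g = 0"
  using component_family by (simp add: fin_supp_families_def)

lemma finite_component: "finite {g. component x g \<noteq> 0}"
  using component_family by (simp add: fin_supp_families_def)

lemma sum_component: "(\<Sum>g | component x g \<noteq> 0. component x g) = x"
  unfolding component_def using bij_betw_inv_into_right[OF families_bij, of x] by simp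

lemma component_unique:
  "f \<in> fin_supp_families \<Gamma> R \<Longrightarrow> (\<Sum>g | f g \<noteq> 0. f g) = x \<Longrightarrow> component x = f"
  unfolding component_def using inv_into_f_f[OF bij_betw_imp_inj_on[OF families_bij], of f] by simp

lemma component_add: "component (x + y) g = component x g + component y g"
proof -
  let ?S = "{g. component x g \<noteq> 0} \<union> {g. component y g \<noteq> 0}"
  have fin: "finite ?S"
    using finite_component by simp
  have sub: "{g. component x g + component y g \<noteq> 0} \<subseteq> ?S"
    by auto
  have "(\<Sum>g | component x g + component y g \<noteq> 0. component x g + component y g) = (\<Sum>g\<in>?S. component x g + component y g)"
    by (rule sum.mono_neutral_left[OF fin sub]) auto
  also have "\<dots> = (\<Sum>g\<in>?S. component x g) + (\<Sum>g\<in>?S. component y g)"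
    by (rule sum.distrib)
  also have "(\<Sum>g\<in>?S. component x g) = (\<Sum>g | component x g \<noteq> 0. component x g)"
    by (rule sum.mono_neutral_right[OF fin]) auto
  also have "(\<Sum>g\<in>?S. component y g) = (\<Sum>g | component y g \<noteq> 0. component y g)"
    by (rule sum.mono_neutral_right[OF fin]) auto
  finally have "(\<Sum>g | component x g + component y g \<noteq> 0. component x g + component y g) = x + y"
    by (simp add: sum_component)
  moreover have "(\<lambda>g. component x g + component y g) \<in> fin_supp_families \<Gamma> R"
    using finite_subset[OF sub fin]
    by (auto simp: fin_supp_families_def component_in component_outside add_subgroup_add R_subgroup)
  ultimately have "component (x + y) = (\<lambda>g. component x g + component y g)"
    by (intro component_unique) auto
  then show ?thesis by simp
qed

lemma component_zero [simp]: "component 0 g = 0"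
  using component_add[of 0 0 g] by simp

lemma component_sum: "component (sum f I) g = (\<Sum>i\<in>I. component (f i) g)"
  by (induction I rule: infinite_finite_induct) (auto simp: component_add)

lemma component_homogeneous:
  assumes "g \<in> \<Gamma>" "a \<in> R g"
  shows "component a h = (if h = g then a else 0)"
proof -
  have "{h. (if h = g then a else 0) \<noteq> 0} = (if a = 0 then {} else {g})"
    by auto
  then have "component a = (\<lambda>h. if h = g then a else 0)"
    using assms by (intro component_unique) (auto simp: fin_supp_families_def R_subgroup add_subgroup_zero)
  then show ?thesis by simp
qed

lemma mem_subgroup_if_component:
  assumes H: "add_subgroup H" and component: "\<And>g. g \<in> \<Gamma> \<Longrightarrow> component x g \<in> H"
  shows "x \<in> H"
proof -
  have "(\<Sum>g | component x g \<noteq> 0. component x g) \<in> H"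
    using component component_outside by (intro add_subgroup_sum[OF H]) blast
  then show ?thesis by (simp only: sum_component)
qed

lemma mult_homogeneous:
  assumes "g \<in> \<Gamma>" "h \<in> \<Gamma>" "a \<in> R g" "b \<in> R h"
  shows "component (a * b) k = (if d g = r h \<and> k = g \<cdot> h then a * b else 0)"
proof (cases "d g = r h")
  case True
  then show ?thesis
    using component_homogeneous[OF mlt_closed mult_composable, OF assms(1,2) _ assms(1,2) _ assms(3,4)]
    by simp
next
  case False
  then show ?thesis
    using mult_not_composable assms by simp
qed

text \<open>Families with members in \<open>U \<inter> R g\<close> are among those of
  \<open>R\<close>, where the decomposition of an element is unique, so the direct sum condition
  becomes closure under components. This is the working form of gradedness from here on.\<close>

lemma graded_iff: "gri U \<longleftrightarrow> right_ideal U \<and> (\<forall>u\<in>U. \<forall>g. component u g \<in> U)"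
proof (intro iffI conjI ballI allI)
  assume "gri U"
  then show "right_ideal U" by (simp add: graded_right_ideal_def)
  fix u g assume "u \<in> U"
  have "bij_betw (\<lambda>f. \<Sum>i | f i \<noteq> 0. f i) (fin_supp_families \<Gamma> (\<lambda>g. U \<inter> R g)) U"
    using \<open>gri U\<close> by (simp add: graded_right_ideal_def is_direct_sum_def)
  then obtain f where f: "f \<in> fin_supp_families \<Gamma> (\<lambda>g. U \<inter> R g)" "u = (\<Sum>i | f i \<noteq> 0. f i)"
    using \<open>u \<in> U\<close> unfolding bij_betw_def by blast
  then have "component u = f"
    by (intro component_unique) (auto simp: fin_supp_families_def)
  then show "component u g \<in> U"
    using f \<open>right_ideal U\<close> add_subgroup_zero[of U]
    by (cases "g \<in> \<Gamma>") (auto simp: fin_supp_families_def right_ideal_def)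
next
  assume U: "right_ideal U \<and> (\<forall>u\<in>U. \<forall>g. component u g \<in> U)"
  let ?F = "fin_supp_families \<Gamma> (\<lambda>g. U \<inter> R g)"
  have sub: "?F \<subseteq> fin_supp_families \<Gamma> R"
    by (auto simp: fin_supp_families_def)
  have "(\<lambda>f. \<Sum>i | f i \<noteq> 0. f i) ` ?F = U"
  proof (intro equalityI subsetI)
    fix x assume "x \<in> (\<lambda>f. \<Sum>i | f i \<noteq> 0. f i) ` ?F"
    then obtain f where f: "f \<in> ?F" "x = (\<Sum>i | f i \<noteq> 0. f i)"
      by (elim imageE)
    then have "f i \<in> U" if "f i \<noteq> 0" for i
      using that by (auto simp: fin_supp_families_def)
    then show "x \<in> U"
      using U f(2) add_subgroup_sum[of U "{i. f i \<noteq> 0}" f] by (simp add: right_ideal_subgroup)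
  next
    fix x assume "x \<in> U"
    then have "component x \<in> ?F"
      using U component_family[of x] by (simp add: fin_supp_families_def)
    then show "x \<in> (\<lambda>f. \<Sum>i | f i \<noteq> 0. f i) ` ?F"
      by (rule rev_image_eqI) (simp add: sum_component)
  qed
  then have "bij_betw (\<lambda>f. \<Sum>i | f i \<noteq> 0. f i) ?F U"
    using inj_on_subset[OF bij_betw_imp_inj_on[OF families_bij] sub] by (simp add: bij_betw_def)
  then show "gri U"
    using U by (simp add: graded_right_ideal_def is_direct_sum_def right_ideal_subgroup
        add_subgroup_Int R_subgroup)
qed

lemma gri_right_ideal: "gri U \<Longrightarrow> right_ideal U"
  by (simp add: graded_iff)

lemma gri_subgroup: "gri U \<Longrightarrow> add_subgroup U"
  by (simp add: graded_iff right_ideal_def)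

lemma gri_component: "gri U \<Longrightarrow> u \<in> U \<Longrightarrow> component u g \<in> U"
  by (simp add: graded_iff)

lemma gri_mult: "gri U \<Longrightarrow> u \<in> U \<Longrightarrow> u * x \<in> U"
  by (simp add: graded_iff right_ideal_def)

lemma gri_homogeneous_witness:
  assumes "gri V" "gri W" "\<not> W \<subseteq> V"
  obtains g w where "g \<in> \<Gamma>" "w \<in> R g" "w \<in> W" "w \<notin> V"
proof -
  obtain x where "x \<in> W" "x \<notin> V"
    using assms by blast
  then obtain g where "g \<in> \<Gamma>" "component x g \<notin> V"
    using mem_subgroup_if_component gri_subgroup[OF assms(1)] by blast
  then show ?thesis
    using that[of g "component x g"] component_in gri_component[OF assms(2) \<open>x \<in> W\<close>] by blast
qed

section \<open>Degrees and components of products\<close>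

lemma mlt_left_cancel:
  assumes "g \<in> \<Gamma>" "h \<in> \<Gamma>" "k \<in> \<Gamma>" "d g = r h" "d g = r k" "g \<cdot> h = g \<cdot> k"
  shows "h = k"
proof -
  obtain g' where g': "g' \<in> \<Gamma>" "d g' = r g" "g' \<cdot> g = d g"
    using invertible assms(1) by blast
  have "(g' \<cdot> g) \<cdot> h = (g' \<cdot> g) \<cdot> k"
    using assms g' mlt_assoc[of g' g h] mlt_assoc[of g' g k] by simp
  then show ?thesis
    using assms g' r_mlt_left by metis
qed

lemma mlt_right_cancel:
  assumes "g \<in> \<Gamma>" "h \<in> \<Gamma>" "k \<in> \<Gamma>" "d h = r g" "d k = r g" "h \<cdot> g = k \<cdot> g"
  shows "h = k"
proof -
  obtain g' where g': "g' \<in> \<Gamma>" "r g' = d g" "g \<cdot> g' = r g"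
    using invertible assms(1) by blast
  have "h \<cdot> (g \<cdot> g') = k \<cdot> (g \<cdot> g')"
    using assms g' mlt_assoc[of h g g'] mlt_assoc[of k g g'] by simp
  then show ?thesis
    using assms g' mlt_d_right by metis
qed

lemma component_mult_expand_right: "component (w * x) k = (\<Sum>h | component x h \<noteq> 0. component (w * component x h) k)"
proof -
  have "component (w * x) k = component (w * (\<Sum>h | component x h \<noteq> 0. component x h)) k"
    by (simp only: sum_component)
  also have "\<dots> = (\<Sum>h | component x h \<noteq> 0. component (w * component x h) k)"
    by (simp only: sum_distrib_left component_sum)
  finally show ?thesis .
qed

lemma component_mult_expand_left: "component (x * w) k = (\<Sum>h | component x h \<noteq> 0. component (component x h * w) k)"
proof -
  have "component (x * w) k = component ((\<Sum>h | component x h \<noteq> 0. component x h) * w) k"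
    by (simp only: sum_component)
  also have "\<dots> = (\<Sum>h | component x h \<noteq> 0. component (component x h * w) k)"
    by (simp only: sum_distrib_right component_sum)
  finally show ?thesis .
qed

text \<open>By \<open>mlt_left_cancel\<close> distinct degrees stay distinct after multiplication by
  \<open>g\<close>, so only \<open>component x h\<close> contributes to degree
  \<open>g \<cdot> h\<close>. This is where invertibility in \<Gamma> takes effect.\<close>

lemma component_mult_left:
  assumes w: "g \<in> \<Gamma>" "w \<in> R g" and h: "h \<in> \<Gamma>" "d g = r h"
  shows "component (w * x) (g \<cdot> h) = w * component x h"
proof -
  have "component (w * x) (g \<cdot> h) = (\<Sum>k | component x k \<noteq> 0. component (w * component x k) (g \<cdot> h))"
    by (rule component_mult_expand_right)
  also have "\<dots> = (\<Sum>k | component x k \<noteq> 0. if k = h then w * component x k else 0)"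
  proof (intro sum.cong refl)
    fix k assume "k \<in> {k. component x k \<noteq> 0}"
    then have "k \<in> \<Gamma>" using component_outside by blast
    then show "component (w * component x k) (g \<cdot> h) = (if k = h then w * component x k else 0)"
      using mult_homogeneous[OF w(1) _ w(2) component_in] h mlt_left_cancel[OF w(1)] by auto
  qed
  also have "\<dots> = w * component x h"
    using finite_component[of x] by simp
  finally show ?thesis .
qed

lemma component_mult_right:
  assumes w: "g \<in> \<Gamma>" "w \<in> R g" and h: "h \<in> \<Gamma>" "d h = r g"
  shows "component (x * w) (h \<cdot> g) = component x h * w"
proof -
  have "component (x * w) (h \<cdot> g) = (\<Sum>k | component x k \<noteq> 0. component (component x k * w) (h \<cdot> g))"
    by (rule component_mult_expand_left)
  also have "\<dots> = (\<Sum>k | component x k \<noteq> 0. if k = h then component x k * w else 0)"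
  proof (intro sum.cong refl)
    fix k assume "k \<in> {k. component x k \<noteq> 0}"
    then have "k \<in> \<Gamma>" using component_outside by blast
    then show "component (component x k * w) (h \<cdot> g) = (if k = h then component x k * w else 0)"
      using mult_homogeneous[OF _ w(1) component_in w(2)] h mlt_right_cancel[OF w(1)] by auto
  qed
  also have "\<dots> = component x h * w"
    using finite_component[of x] by simp
  finally show ?thesis .
qed

section \<open>Constructions of graded right ideals\<close>

lemma gri_zero: "gri {0}"
  by (auto simp: graded_iff right_ideal_def add_subgroup_def)

lemma gri_plus:
  assumes A: "gri A" and B: "gri B"
  shows "gri (A + B)"
  unfolding graded_iff
proof (intro conjI ballI allI)
  show "right_ideal (A + B)"
    using A B by (intro right_ideal_plus gri_right_ideal)
  fix u g assume "u \<in> A + B"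
  then obtain a b where "a \<in> A" "b \<in> B" "u = a + b"
    by (metis set_plus_elim)
  then show "component u g \<in> A + B"
    using A B by (simp add: component_add set_plus_intro gri_component)
qed

lemma gri_Int: "gri A \<Longrightarrow> gri B \<Longrightarrow> gri (A \<inter> B)"
  by (auto simp: graded_iff right_ideal_def add_subgroup_def)

lemma gri_Inter: "(\<And>A. A \<in> \<A> \<Longrightarrow> gri A) \<Longrightarrow> gri (\<Inter>\<A>)"
  by (auto simp: graded_iff right_ideal_def add_subgroup_def)

lemma gri_J: "gri J"
  unfolding gr_rad_def by (rule gri_Inter) (simp add: gr_maximal_right_ideal_def)

text \<open>Homogeneity of \<open>w\<close> makes this work: if \<open>w * u\<close> lies in
  \<open>Z\<close>, then so do its components, and in composable degrees these are the products
  \<open>w * component u h\<close>; in the other degrees the product is 0.\<close>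

lemma gri_colon:
  assumes Z: "gri Z" and w: "g \<in> \<Gamma>" "w \<in> R g"
  shows "gri {x. w * x \<in> Z}"
  unfolding graded_iff right_ideal_def
proof (intro conjI ballI allI)
  show "add_subgroup {x. w * x \<in> Z}"
    by (intro add_subgroup_vimage gri_subgroup Z) (simp add: distrib_left)
next
  fix u x assume "u \<in> {x. w * x \<in> Z}"
  then show "u * x \<in> {x. w * x \<in> Z}"
    using gri_mult[OF Z, of "w * u" x] by (simp add: mult.assoc)
next
  fix u h assume u: "u \<in> {x. w * x \<in> Z}"
  consider "h \<notin> \<Gamma>" | "h \<in> \<Gamma>" "d g = r h" | "h \<in> \<Gamma>" "d g \<noteq> r h"
    by blast
  then show "component u h \<in> {x. w * x \<in> Z}"
  proof cases
    case 1
    then show ?thesis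
      using add_subgroup_zero[OF gri_subgroup[OF Z]] by (simp add: component_outside)
  next
    case 2
    then show ?thesis
      using component_mult_left[OF w 2, of u] gri_component[OF Z, of "w * u" "g \<cdot> h"] u by simp
  next
    case 3
    then show ?thesis
      using mult_not_composable[OF w(1) 3 w(2) component_in] add_subgroup_zero[OF gri_subgroup[OF Z]]
      by simp
  qed
qed

text \<open>Each homogeneous part of \<open>t\<close> contributes to a given component of
  \<open>w * t\<close> either \<open>w\<close> times that part or 0, and the parts of
  \<open>t\<close> stay in \<open>T\<close>.\<close>

lemma gri_translate:
  assumes T: "gri T" and w: "g \<in> \<Gamma>" "w \<in> R g"
  shows "gri ((*) w ` T)"
  unfolding graded_iff right_ideal_def
proof (intro conjI ballI allI)
  show sub: "add_subgroup ((*) w ` T)"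
    by (intro add_subgroup_image gri_subgroup T) (simp add: distrib_left)
  fix u assume "u \<in> (*) w ` T"
  then obtain t where t: "t \<in> T" "u = w * t"
    by blast
  show "u * x \<in> (*) w ` T" for x
    using gri_mult[OF T t(1)] t(2) by (auto simp: mult.assoc)
  show "component u k \<in> (*) w ` T" for k
    unfolding t(2) component_mult_expand_right[of w t]
  proof (intro add_subgroup_sum[OF sub])
    fix h assume "h \<in> {h. component t h \<noteq> 0}"
    then have "h \<in> \<Gamma>" using component_outside by blast
    then show "component (w * component t h) k \<in> (*) w ` T"
      using mult_homogeneous[OF w(1) _ w(2) component_in] gri_component[OF T t(1)] add_subgroup_zero[OF sub]
      by simp
  qed
qed

lemma gri_ideal_mult:
  assumes U: "gri U" and V: "gri V"
  shows "gri (ideal_mult U V)"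
  unfolding graded_iff
proof (intro conjI ballI allI)
  show "right_ideal (ideal_mult U V)"
    by (intro right_ideal_ideal_mult gri_right_ideal V)
  fix x k assume x: "x \<in> ideal_mult U V"
  have "ideal_mult U V \<subseteq> {x. component x k \<in> ideal_mult U V}"
  proof (intro ideal_mult_least add_subgroup_vimage ideal_mult_subgroup)
    fix u v assume u: "u \<in> U" and v: "v \<in> V"
    \<comment> \<open>\<open>u\<close> is split into homogeneous parts, so that
      \<open>gri_translate\<close> applies to each product \<open>component u h * v\<close>
      separately.\<close>
    have hom: "component (component u h * v) k \<in> ideal_mult U V" if "h \<in> \<Gamma>" for h
    proof -
      have "gri ((*) (component u h) ` V)"
        by (intro gri_translate[OF V that component_in[OF that]])
      then have "component (component u h * v) k \<in> (*) (component u h) ` V"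
        by (intro gri_component) (use v in auto)
      then show ?thesis
        using ideal_multI[OF gri_component[OF U u, of h]] by auto
    qed
    have "(\<Sum>h | component u h \<noteq> 0. component (component u h * v) k) \<in> ideal_mult U V"
      using hom component_outside by (intro add_subgroup_sum[OF ideal_mult_subgroup]) blast
    then show "u * v \<in> {x. component x k \<in> ideal_mult U V}"
      by (simp only: component_mult_expand_left[of u v] mem_Collect_eq)
  qed (simp add: component_add)
  then show "component x k \<in> ideal_mult U V"
    using x by blast
qed

lemma gri_power: "n \<ge> 1 \<Longrightarrow> gri (ideal_power J n)"
  by (induction n rule: nat_induct_at_least) (auto simp: gri_J gri_ideal_mult)

lemma ideal_mult_subset: "gri U \<Longrightarrow> ideal_mult U V \<subseteq> U"
  by (intro ideal_mult_least gri_subgroup gri_mult)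

lemma power_subset_J: "n \<ge> 1 \<Longrightarrow> ideal_power J n \<subseteq> J"
proof (induction n rule: nat_induct_at_least)
  case (Suc n)
  then show ?case
    using ideal_mult_subset[OF gri_power, of n J] by simp
qed simp

section \<open>Slices of graded right ideals at the objects of \<Gamma>\<close>

abbreviation objs :: "'g set" where
  "objs \<equiv> identities \<Gamma> d"

lemma r_objs: "g \<in> \<Gamma> \<Longrightarrow> r g \<in> objs"
  unfolding identities_def using d_r r_closed by (metis imageI)

lemma objs_closed: "e \<in> objs \<Longrightarrow> e \<in> \<Gamma>"
  by (auto simp: identities_def d_closed)

lemma objs_d: "e \<in> objs \<Longrightarrow> d e = e"
  by (auto simp: identities_def d_d)

lemma objs_r: "e \<in> objs \<Longrightarrow> r e = e"
  by (auto simp: identities_def r_d)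

text \<open>The unit axiom makes \<open>one e\<close> fix the components of range \<open>e\<close>;
  it annihilates the others, whose degrees cannot be composed with \<open>e\<close>.\<close>

lemma component_one_mult:
  assumes e: "e \<in> objs"
  shows "component (one e * x) g = (if g \<in> \<Gamma> \<and> r g = e then component x g else 0)"
proof -
  have "component (one e * x) g = (\<Sum>h | component x h \<noteq> 0. component (one e * component x h) g)"
    by (rule component_mult_expand_right)
  also have "\<dots> = (\<Sum>h | component x h \<noteq> 0. if h = g then (if g \<in> \<Gamma> \<and> r g = e then component x g else 0) else 0)"
  proof (intro sum.cong refl)
    fix h assume "h \<in> {h. component x h \<noteq> 0}"
    then have h: "h \<in> \<Gamma>" using component_outside by blast
    show "component (one e * component x h) g = (if h = g then (if g \<in> \<Gamma> \<and> r g = e then component x g else 0) else 0)"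
    proof (cases "r h = e")
      case True
      then have "one e * component x h = component x h"
        using one_left[OF h component_in[OF h]] by simp
      then show ?thesis
        using True h component_homogeneous[OF h component_in[OF h], of x g] by auto
    next
      case False
      then have "one e * component x h = 0"
        using mult_not_composable[OF objs_closed[OF e] h _ one_in[OF e] component_in[OF h]] objs_d[OF e]
        by simp
      then show ?thesis using False by auto
    qed
  qed
  also have "\<dots> = (if g \<in> \<Gamma> \<and> r g = e then component x g else 0)"
    using finite_component[of x] by simp
  finally show ?thesis .
qed

lemma eq_if_component:
  assumes "\<And>g. component x g = component y g"
  shows "x = y"
proof -
  have "component x = component y" using assms by (rule ext)
  then show ?thesis by (metis sum_component)
qed

lemma one_one_mult:
  assumes "e \<in> objs" "f \<in> objs"
  shows "one f * (one e * x) = (if f = e then one e * x else 0)"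
  by (rule eq_if_component) (use assms in \<open>simp add: component_one_mult\<close>)

lemma one_mult_mem: "gri U \<Longrightarrow> e \<in> objs \<Longrightarrow> u \<in> U \<Longrightarrow> one e * u \<in> U"
  by (rule mem_subgroup_if_component) (simp_all add: component_one_mult gri_component gri_subgroup add_subgroup_zero)

lemma gri_at: "gri U \<Longrightarrow> e \<in> objs \<Longrightarrow> gri (ideal_at one U e)"
  unfolding ideal_at_def by (rule gri_translate[OF _ objs_closed one_in])

lemma mem_at:
  assumes "gri U" "e \<in> objs"
  shows "x \<in> ideal_at one U e \<longleftrightarrow> x \<in> U \<and> one e * x = x"
proof
  assume "x \<in> ideal_at one U e"
  then obtain u where "u \<in> U" "x = one e * u"
    unfolding ideal_at_def by blast
  then show "x \<in> U \<and> one e * x = x"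
    using one_mult_mem[OF assms] one_one_mult[OF assms(2,2), of u] by simp
next
  assume "x \<in> U \<and> one e * x = x"
  then show "x \<in> ideal_at one U e"
    unfolding ideal_at_def by (intro rev_image_eqI[of x]) auto
qed

text \<open>The component of degree \<open>g\<close> survives in \<open>one (r g) * x\<close>, so
  membership can be tested slice by slice without a unit of the whole ring.\<close>

lemma mem_if_one_mult:
  assumes "gri U" "\<And>e. e \<in> objs \<Longrightarrow> one e * x \<in> U"
  shows "x \<in> U"
proof (rule mem_subgroup_if_component[OF gri_subgroup[OF assms(1)]])
  fix g assume g: "g \<in> \<Gamma>"
  have "component (one (r g) * x) g \<in> U"
    using assms r_objs[OF g] by (intro gri_component)
  then show "component x g \<in> U"
    using g by (simp add: component_one_mult r_objs)
qed

lemma subset_if_at: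
  assumes "gri V" "\<And>e. e \<in> objs \<Longrightarrow> ideal_at one U e \<subseteq> ideal_at one V e"
  shows "U \<subseteq> V"
proof
  fix x assume "x \<in> U"
  show "x \<in> V"
  proof (rule mem_if_one_mult[OF assms(1)])
    fix e assume e: "e \<in> objs"
    have "one e * x \<in> ideal_at one U e"
      using \<open>x \<in> U\<close> by (simp add: ideal_at_def)
    then show "one e * x \<in> V"
      using assms(2)[OF e] mem_at[OF assms(1) e] by blast
  qed
qed

lemma eq_if_at:
  assumes "gri U" "gri V" "\<And>e. e \<in> objs \<Longrightarrow> ideal_at one U e = ideal_at one V e"
  shows "U = V"
  using subset_if_at[of V U] subset_if_at[of U V] assms by simp

lemma at_mono: "U \<subseteq> V \<Longrightarrow> ideal_at one U e \<subseteq> ideal_at one V e"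
  unfolding ideal_at_def by blast

lemma gri_UNIV: "gri UNIV"
  by (simp add: graded_iff right_ideal_def add_subgroup_def)

text \<open>Left multiplication by \<open>one e\<close> is additive and associates with products, so
  the slice of a product depends on the left factor only through its slice. For powers of
  \<open>J\<close>, a repetition at \<open>e\<close> therefore persists.\<close>

lemma at_ideal_mult:
  assumes "e \<in> objs"
  shows "ideal_at one (ideal_mult U V) e = ideal_mult (ideal_at one U e) V"
proof
  have "ideal_mult U V \<subseteq> {x. one e * x \<in> ideal_mult (ideal_at one U e) V}"
    by (intro ideal_mult_least add_subgroup_vimage ideal_mult_subgroup)
       (auto simp: distrib_left mult.assoc[symmetric] ideal_at_def intro!: ideal_multI)
  then show "ideal_at one (ideal_mult U V) e \<subseteq> ideal_mult (ideal_at one U e) V"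
    by (auto simp: ideal_at_def)
  show "ideal_mult (ideal_at one U e) V \<subseteq> ideal_at one (ideal_mult U V) e"
    unfolding ideal_at_def
    by (intro ideal_mult_least add_subgroup_image ideal_mult_subgroup)
       (auto simp: distrib_left mult.assoc intro!: imageI ideal_multI)
qed

section \<open>Simple quotients and the radical\<close>

text \<open>This says that \<open>U / M\<close> is gr-simple; pairs of ideals take the place of
  quotient modules.\<close>

definition covers :: "'a set \<Rightarrow> 'a set \<Rightarrow> bool" where
  "covers U M \<longleftrightarrow> gri U \<and> gri M \<and> M \<subset> U \<and> (\<forall>Z. gri Z \<longrightarrow> M \<subseteq> Z \<longrightarrow> Z \<subseteq> U \<longrightarrow> Z = M \<or> Z = U)"

lemma plus_maximal:
  assumes "gr_maximal_right_ideal \<Gamma> R M" "gri A" "\<not> A \<subseteq> M"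
  shows "A + M = UNIV"
proof (rule ccontr)
  have M: "gri M"
    using assms by (simp add: gr_maximal_right_ideal_def)
  assume "A + M \<noteq> UNIV"
  then have "A + M = M"
    using assms gri_plus[OF assms(2) M] subset_plus_right[OF gri_subgroup[OF assms(2)]]
    by (simp add: gr_maximal_right_ideal_def)
  then show False
    using assms(3) subset_plus_left[OF gri_subgroup[OF M], of A] by simp
qed

text \<open>For a homogeneous \<open>u\<close>, the right ideal \<open>(M : u)\<close> is either everything or gr-maximal.\<close>

lemma covers_mult_J:
  assumes cov: "covers U M" and u: "u \<in> U" and x: "x \<in> J"
  shows "u * x \<in> M"
proof -
  have U: "gri U" and M: "gri M" and MU: "M \<subseteq> U"
    using cov by (auto simp: covers_def)
  have hom: "w * x \<in> M" if w: "w \<in> U" "g \<in> \<Gamma>" "w \<in> R g" for w g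
  proof (cases "{x. w * x \<in> M} = UNIV")
    case True
    then show ?thesis by blast
  next
    case False
    have A: "gri {x. w * x \<in> M}"
      using gri_colon[OF M w(2,3)] .
    have "gr_maximal_right_ideal \<Gamma> R {x. w * x \<in> M}"
      unfolding gr_maximal_right_ideal_def
    proof (intro conjI A False allI impI)
      fix N assume N: "gri N \<and> N \<noteq> UNIV \<and> {x. w * x \<in> M} \<subseteq> N"
      \<comment> \<open>\<open>N\<close> is recovered from \<open>M + w N\<close>: if this is
        \<open>M\<close>, then \<open>N\<close> lies in the colon ideal; if it is \<open>U\<close>,
        then \<open>N\<close> is the whole ring, because the kernel of
        \<open>y \<mapsto> w * y\<close> modulo \<open>M\<close> lies in \<open>N\<close>.\<close>
      let ?Z = "M + (*) w ` N"
      have wN: "gri ((*) w ` N)"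
        using gri_translate N w by blast
      have Z: "gri ?Z"
        using gri_plus[OF M wN] .
      have "?Z \<subseteq> U"
        by (intro plus_least gri_subgroup U MU) (use gri_mult[OF U w(1)] in auto)
      moreover have MZ: "M \<subseteq> ?Z"
        by (intro subset_plus_left gri_subgroup wN)
      ultimately consider "?Z = M" | "?Z = U"
        using cov Z unfolding covers_def by blast
      then show "N = {x. w * x \<in> M}"
      proof cases
        case 1
        then show ?thesis
          using N subset_plus_right[OF gri_subgroup[OF M], of "(*) w ` N"] by blast
      next
        case 2
        have "y \<in> N" for y
        proof -
          have "w * y \<in> ?Z"
            using 2 gri_mult[OF U w(1)] by simp
          then obtain m n where mn: "m \<in> M" "n \<in> N" "w * y = m + w * n"
            by (auto elim!: set_plus_elim)
          then have "w * (y - n) \<in> M"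
            by (simp add: right_diff_distrib)
          then have "y - n \<in> N"
            using N by blast
          then show ?thesis
            using mn(2) N add_subgroup_add[OF gri_subgroup, of N "y - n" n] by simp
        qed
        then show ?thesis using N by blast
      qed
    qed
    then show ?thesis
      using x by (auto simp: gr_rad_def)
  qed
  have "(\<Sum>g | component u g \<noteq> 0. component u g) * x \<in> M"
    unfolding sum_distrib_right
  proof (intro add_subgroup_sum gri_subgroup M)
    fix g assume "g \<in> {g. component u g \<noteq> 0}"
    then have "g \<in> \<Gamma>" using component_outside by blast
    then show "component u g * x \<in> M"
      using hom[OF gri_component[OF U u] _ component_in] by blast
  qed
  then show ?thesis by (simp only: sum_component)
qed

text \<open>Well-foundedness is the form of the descending chain condition that yields minimal
  members of families; the bound on \<open>V\<close> confines \<open>U\<close> to the slice as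
  well.\<close>

definition dcc_at :: "'g \<Rightarrow> bool" where
  "dcc_at e \<longleftrightarrow> wf {(U, V). gri U \<and> gri V \<and> U \<subset> V \<and> V \<subseteq> ideal_at one UNIV e}"

lemma dcc_at_minimal:
  assumes "dcc_at e" "P U" and P: "\<And>U. P U \<Longrightarrow> gri U \<and> U \<subseteq> ideal_at one UNIV e"
  obtains T where "P T" "\<And>Z. P Z \<Longrightarrow> Z \<subseteq> T \<Longrightarrow> Z = T"
proof -
  have "wf {(U, V). gri U \<and> gri V \<and> U \<subset> V \<and> V \<subseteq> ideal_at one UNIV e}" "U \<in> Collect P"
    using assms by (simp_all add: dcc_at_def)
  then show ?thesis
  proof (rule wfE_min)
    fix T assume T: "T \<in> Collect P" and min: "\<And>Z. (Z, T) \<in> {(U, V). gri U \<and> gri V \<and> U \<subset> V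
      \<and> V \<subseteq> ideal_at one UNIV e} \<Longrightarrow> Z \<notin> Collect P"
    show ?thesis
    proof (rule that)
      show "P T" using T by simp
      fix Z assume "P Z" "Z \<subseteq> T"
      then show "Z = T"
        using min[of Z] P[of Z] P[of T] T by auto
    qed
  qed
qed

section \<open>The radical as a two-sided ideal, and annihilators\<close>

lemma maximal_covers: "gr_maximal_right_ideal \<Gamma> R M \<Longrightarrow> covers UNIV M"
  unfolding gr_maximal_right_ideal_def covers_def using gri_UNIV by blast

text \<open>The ring covers each gr-maximal right ideal, so \<open>covers_mult_J\<close> puts
  \<open>y * x\<close> into all of them.\<close>

lemma J_left_ideal: "x \<in> J \<Longrightarrow> y * x \<in> J"
  using covers_mult_J[OF maximal_covers] by (auto simp: gr_rad_def[of \<Gamma> R])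

lemma power_left_ideal:
  assumes "n \<ge> 1" "x \<in> ideal_power J n"
  shows "y * x \<in> ideal_power J n"
  using assms
proof (induction n arbitrary: x rule: nat_induct_at_least)
  case base
  then show ?case by (simp add: J_left_ideal)
next
  case (Suc n)
  have "ideal_mult (ideal_power J n) J \<subseteq> {x. y * x \<in> ideal_mult (ideal_power J n) J}"
    using Suc.IH by (intro ideal_mult_least add_subgroup_vimage ideal_mult_subgroup)
      (simp_all add: distrib_left mult.assoc[symmetric] ideal_multI)
  then show ?case using Suc.prems Suc.hyps by auto
qed

text \<open>Absorption from the left by \<open>I\<close> makes this a right ideal. For gradedness,
  \<open>component v g * component x h\<close> in composable degrees is a component of
  \<open>v * component x h\<close>, which is 0 because \<open>component x h\<close> lies in the
  graded ideal \<open>I\<close>.\<close>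

lemma gri_annihilator:
  assumes I: "gri I" and left: "\<And>y x. x \<in> I \<Longrightarrow> y * x \<in> I"
  shows "gri {v. \<forall>x\<in>I. v * x = 0}"
  unfolding graded_iff
proof (intro conjI ballI allI)
  show "right_ideal {v. \<forall>x\<in>I. v * x = 0}"
    by (auto simp: right_ideal_def add_subgroup_def distrib_right mult.assoc left)
  fix v g assume v: "v \<in> {v. \<forall>x\<in>I. v * x = 0}"
  have "component v g * x = 0" if x: "x \<in> I" and g: "g \<in> \<Gamma>" for x
  proof -
    have "component v g * component x h = 0" if h: "h \<in> \<Gamma>" for h
    proof (cases "d g = r h")
      case True
      have "v * component x h = 0"
        using v gri_component[OF I x] by blast
      then show ?thesis
        using component_mult_right[OF h component_in[OF h] g True, of v x] by simp
    next
      case False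
      then show ?thesis
        using mult_not_composable g h component_in by blast
    qed
    then have "(\<Sum>h | component x h \<noteq> 0. component v g * component x h) = 0"
      using component_outside by (intro sum.neutral) blast
    then have "component v g * (\<Sum>h | component x h \<noteq> 0. component x h) = 0"
      by (simp only: sum_distrib_left)
    then show ?thesis
      by (simp only: sum_component)
  qed
  then show "component v g \<in> {v. \<forall>x\<in>I. v * x = 0}"
    using component_outside[of g v] by (cases "g \<in> \<Gamma>") auto
qed

section \<open>Nilpotency of the radical\<close>

lemma at_within:
  assumes "gri U" "U \<subseteq> ideal_at one UNIV e" "e \<in> objs" "f \<in> objs"
  shows "ideal_at one U f = (if f = e then U else {0})"
proof -
  have u: "one e * u = u" if "u \<in> U" for u
    using that assms(2) mem_at[OF gri_UNIV assms(3)] by blast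
  show ?thesis
  proof (cases "f = e")
    case True
    then show ?thesis using u by (simp add: ideal_at_def)
  next
    case False
    then have "one f * u = 0" if "u \<in> U" for u
      using one_one_mult[OF assms(3,4), of u] u[OF that] by simp
    then show ?thesis
      using False add_subgroup_zero[OF gri_subgroup[OF assms(1)]]
      unfolding ideal_at_def by (auto intro!: rev_image_eqI[of 0])
  qed
qed

lemma strongly_artinian_if_artinian:
  "right_gr_artinian \<Gamma> R \<Longrightarrow> right_strongly_artinian \<Gamma> d R one"
  unfolding right_gr_artinian_def right_strongly_artinian_def by blast

text \<open>For a strict chain inside one slice the stopping condition is automatic: at
  \<open>e\<close> nothing repeats, and at every other object all slices are \<open>{0}\<close> by
  \<open>at_within\<close>.\<close>

lemma dcc_at_if_strongly_artinian:
  assumes art: "right_strongly_artinian \<Gamma> d R one" and e: "e \<in> objs"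
  shows "dcc_at e"
  unfolding dcc_at_def wf_iff_no_infinite_down_chain
proof
  assume "\<exists>U. \<forall>i. (U (Suc i), U i) \<in>
    {(U, V). gri U \<and> gri V \<and> U \<subset> V \<and> V \<subseteq> ideal_at one UNIV e}"
  then obtain U where "\<forall>i. (U (Suc i), U i) \<in>
    {(U, V). gri U \<and> gri V \<and> U \<subset> V \<and> V \<subseteq> ideal_at one UNIV e}"
    by (rule exE)
  then have U: "gri (U i)" "U (Suc i) \<subset> U i" "U i \<subseteq> ideal_at one UNIV e" for i
    by simp_all
  have "U (Suc i) \<noteq> U i" for i
    using U(2)[of i] by simp
  have "stops_at_repetition objs one U"
    unfolding stops_at_repetition_def
  proof (intro ballI allI impI)
    fix f i l assume f: "f \<in> objs" "ideal_at one (U i) f = ideal_at one (U (Suc i)) f"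
    then have "f \<noteq> e"
      using \<open>U (Suc i) \<noteq> U i\<close> at_within[OF U(1,3) e f(1), of i] at_within[OF U(1,3) e f(1), of "Suc i"]
      by auto
    then show "ideal_at one (U i) f = ideal_at one (U (i + l)) f"
      using at_within[OF U(1,3) e f(1)] by simp
  qed
  then show False
    using art U(1,2) unfolding right_strongly_artinian_def by blast
qed

text \<open>The powers form a weakly descending chain with the stopping condition, by
  \<open>at_ideal_mult\<close>; some inclusion must then fail to be strict.\<close>

lemma power_J_stabilizes:
  assumes art: "right_strongly_artinian \<Gamma> d R one"
  obtains n where "n \<ge> 1" "ideal_mult (ideal_power J n) J = ideal_power J n"
proof -
  \<comment> \<open>The shift avoids exponent 0, at which \<open>ideal_power\<close> is by
    convention the whole ring.\<close>
  define U where "U i = ideal_power J (Suc i)" for i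
  have U_Suc: "U (Suc i) = ideal_mult (U i) J" for i
    by (simp add: U_def)
  have gri: "gri (U i)" for i
    unfolding U_def by (rule gri_power) simp
  have sub: "U (Suc i) \<subseteq> U i" for i
    unfolding U_Suc by (rule ideal_mult_subset[OF gri])
  have "stops_at_repetition objs one U"
    unfolding stops_at_repetition_def
  proof (intro ballI allI impI)
    fix e i l assume e: "e \<in> objs" and eq: "ideal_at one (U i) e = ideal_at one (U (Suc i)) e"
    show "ideal_at one (U i) e = ideal_at one (U (i + l)) e"
    proof (induction l)
      case 0
      show ?case by simp
    next
      case (Suc l)
      show ?case
        using Suc.IH eq unfolding add_Suc_right U_Suc at_ideal_mult[OF e] by simp
    qed
  qed
  then have "\<not> (\<forall>i. U (Suc i) \<subset> U i)"
    using art gri unfolding right_strongly_artinian_def by blast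
  then obtain i where "U (Suc i) = U i"
    using sub by blast
  then show ?thesis
    using that[of "Suc i"] U_Suc[of i] unfolding U_def by simp
qed

text \<open>In a right ideal \<open>T\<close> minimal with \<open>T I \<noteq> 0\<close>, the annihilator of \<open>I\<close> is the unique largest
  proper graded subideal.\<close>

lemma nilpotent_J:
  assumes art: "right_strongly_artinian \<Gamma> d R one"
  shows "nilpotent_ideal J"
proof -
  obtain n where n: "n \<ge> 1" "ideal_mult (ideal_power J n) J = ideal_power J n"
    using power_J_stabilizes[OF art] .
  define I where "I = ideal_power J n"
  have I: "gri I" and left: "\<And>x y. x \<in> I \<Longrightarrow> y * x \<in> I" and IJ: "I \<subseteq> J"
    unfolding I_def using gri_power power_left_ideal power_subset_J n(1) by auto
  have II: "ideal_mult I I = I"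
    unfolding I_def by (rule ideal_mult_power_stable[OF n(2,1)])
  have "I = {0}"
  proof (rule ccontr)
    assume "I \<noteq> {0}"
    then obtain e where e: "e \<in> objs" and ne: "ideal_at one I e \<noteq> ideal_at one {0} e"
      using eq_if_at[OF I gri_zero] by blast
    let ?P = "\<lambda>U. gri U \<and> U \<subseteq> ideal_at one UNIV e \<and> \<not> (\<forall>u\<in>U. \<forall>x\<in>I. u * x = 0)"
    \<comment> \<open>Since \<open>I\<close> is idempotent, its slice at \<open>e\<close> equals
      that slice times \<open>I\<close>; were this product zero, so would be the slice, against the
      choice of \<open>e\<close>.\<close>
    have "?P (ideal_at one I e)"
    proof (intro conjI notI)
      show gA: "gri (ideal_at one I e)" using I e by (rule gri_at)
      show "ideal_at one I e \<subseteq> ideal_at one UNIV e" by (rule at_mono) simp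
      assume 0: "\<forall>u\<in>ideal_at one I e. \<forall>x\<in>I. u * x = 0"
      have "ideal_at one I e = ideal_mult (ideal_at one I e) I"
        using at_ideal_mult[OF e, of I I] II by simp
      also have "\<dots> \<subseteq> {0}"
        using 0 by (intro ideal_mult_least gri_subgroup gri_zero) simp
      finally show False
        using ne add_subgroup_zero[OF gri_subgroup[OF gA]] by (auto simp: ideal_at_def)
    qed
    then obtain T where T: "?P T" and min: "\<And>Z. ?P Z \<Longrightarrow> Z \<subseteq> T \<Longrightarrow> Z = T"
      using dcc_at_minimal[OF dcc_at_if_strongly_artinian[OF art e], of ?P] by blast
    define M where "M = T \<inter> {v. \<forall>x\<in>I. v * x = 0}"
    have "covers T M"
      unfolding covers_def
    proof (intro conjI allI impI)
      show "gri T" using T by blast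
      then show "gri M"
        unfolding M_def by (intro gri_Int gri_annihilator I left)
      show "M \<subset> T" using T unfolding M_def by blast
      fix Z assume Z: "gri Z" "M \<subseteq> Z" "Z \<subseteq> T"
      show "Z = M \<or> Z = T"
      proof (cases "\<forall>u\<in>Z. \<forall>x\<in>I. u * x = 0")
        case True
        then show ?thesis using Z unfolding M_def by blast
      next
        case False
        then show ?thesis using min[of Z] Z T by blast
      qed
    qed
    have "u * x = 0" if u: "u \<in> T" and x: "x \<in> I" for u x
    proof -
      \<comment> \<open>For \<open>y\<close> in \<open>I\<close>, hence in \<open>J\<close>, the
        product \<open>u * y\<close> falls into \<open>M\<close>, which annihilates
        \<open>I\<close>. So \<open>u\<close> kills all products \<open>y * z\<close>, and these
        generate \<open>I\<close>.\<close>
      have "ideal_mult I I \<subseteq> {x. u * x \<in> {0}}"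
      proof (intro ideal_mult_least add_subgroup_vimage gri_subgroup gri_zero)
        fix y z assume "y \<in> I" "z \<in> I"
        then have "(u * y) * z = 0"
          using covers_mult_J[OF \<open>covers T M\<close> u, of y] IJ unfolding M_def by blast
        then show "y * z \<in> {x. u * x \<in> {0}}"
          by (simp add: mult.assoc)
      qed (simp add: distrib_left)
      then show ?thesis using x II by auto
    qed
    then show False using T by blast
  qed
  then show ?thesis
    using n(1) unfolding nilpotent_ideal_def I_def by blast
qed

section \<open>Ascending chains\<close>

text \<open>With \<open>f\<close> the source of a homogeneous \<open>w \<in> W - X\<close>, a minimal \<open>T \<subseteq> 1\<^sub>f R\<close> containing \<open>1\<^sub>f J\<close>
  with \<open>w T\<close> not inside \<open>X\<close> is simple modulo \<open>1\<^sub>f J\<close>: otherwise \<open>T\<close> is the sum of two smaller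
  right ideals \<open>T \<inter> M\<close>, \<open>T \<inter> M'\<close> with \<open>M\<close>, \<open>M'\<close> gr-maximal.\<close>

lemma exists_cover_not_in:
  assumes dcc: "\<And>e. e \<in> objs \<Longrightarrow> dcc_at e"
    and V: "gri V" and W: "gri W" and X: "gri X" and VX: "V \<subseteq> X" and VW: "V \<subseteq> W"
    and WX: "\<not> W \<subseteq> X"
    and WJ: "\<And>w j. w \<in> W \<Longrightarrow> j \<in> J \<Longrightarrow> w * j \<in> V"
  obtains S where "covers S V" "S \<subseteq> W" "\<not> S \<subseteq> X"
proof -
  obtain g w where g: "g \<in> \<Gamma>" and w: "w \<in> R g" "w \<in> W" "w \<notin> X"
    using gri_homogeneous_witness[OF X W WX] .
  define f where "f = d g"
  have f: "f \<in> objs"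
    using g by (simp add: f_def identities_def)
  \<comment> \<open>\<open>Y\<close> contains \<open>J\<close> because \<open>w J\<close> lies in
    \<open>V\<close>, but it misses \<open>one f\<close> because \<open>w * one f = w\<close> is
    outside \<open>X\<close>; hence the full slice at \<open>f\<close> is a candidate for
    \<open>?P\<close>.\<close>
  define Y where "Y = {x. w * x \<in> X}"
  have Y: "gri Y"
    unfolding Y_def by (rule gri_colon[OF X g w(1)])
  have JY: "J \<subseteq> Y"
    unfolding Y_def using WJ[OF w(2)] VX by blast
  let ?Rf = "ideal_at one UNIV f"
  have gRf: "gri ?Rf"
    using gri_UNIV f by (rule gri_at)
  let ?P = "\<lambda>T. gri T \<and> J \<inter> ?Rf \<subseteq> T \<and> T \<subseteq> ?Rf \<and> \<not> T \<subseteq> Y"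
  have "one f * one f = one f"
    using one_left[OF objs_closed[OF f] one_in[OF f]] objs_r[OF f] by simp
  then have "one f \<in> ?Rf"
    using mem_at[OF gri_UNIV f] by simp
  moreover have "one f \<notin> Y"
    using one_right[OF g w(1)] w(3) by (simp add: Y_def f_def)
  ultimately have "?P ?Rf"
    using gRf by blast
  then obtain T where T: "?P T" and min: "\<And>Z. ?P Z \<Longrightarrow> Z \<subseteq> T \<Longrightarrow> Z = T"
    using dcc_at_minimal[OF dcc[OF f], of ?P] by blast
  have gT: "gri T" using T by blast
  obtain t where t: "t \<in> T" "t \<notin> Y"
    using T by blast
  then have "t \<notin> J" using JY by blast
  then obtain M where M: "gr_maximal_right_ideal \<Gamma> R M" "t \<notin> M"
    unfolding gr_rad_def by blast
  have gM: "gri M" and JM: "J \<subseteq> M"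
    using M(1) by (auto simp: gr_maximal_right_ideal_def gr_rad_def)
  \<comment> \<open>Cutting \<open>T\<close> down by a gr-maximal \<open>N\<close> keeps the part of
    \<open>J\<close> in the slice, so by minimality only the last clause of \<open>?P\<close> can
    fail.\<close>
  have small: "T \<inter> N \<subseteq> Y" if "gr_maximal_right_ideal \<Gamma> R N" "\<not> T \<subseteq> N" for N
  proof (rule ccontr)
    assume nY: "\<not> T \<inter> N \<subseteq> Y"
    have "gri N" "J \<subseteq> N"
      using that(1) by (auto simp: gr_maximal_right_ideal_def gr_rad_def)
    then have "?P (T \<inter> N)"
      using T nY gri_Int[OF gT \<open>gri N\<close>] by blast
    then show False
      using min[of "T \<inter> N"] that(2) by blast
  qed
  \<comment> \<open>If \<open>y\<close> were outside a gr-maximal \<open>N\<close>, then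
    \<open>t\<close> would split into parts in \<open>T \<inter> M\<close> and
    \<open>T \<inter> N\<close>. By \<open>small\<close> both lie in \<open>Y\<close>, and so would
    \<open>t\<close>.\<close>
  have TM: "T \<inter> M \<subseteq> J"
  proof
    fix y assume y: "y \<in> T \<inter> M"
    show "y \<in> J"
    proof (rule ccontr)
      assume "y \<notin> J"
      then obtain N where N: "gr_maximal_right_ideal \<Gamma> R N" "y \<notin> N"
        unfolding gr_rad_def by blast
      have sum: "T \<inter> M + N = UNIV"
        using y N(2) by (intro plus_maximal[OF N(1) gri_Int[OF gT gM]]) blast
      have "t \<in> T \<inter> M + N" unfolding sum ..
      then obtain a b where ab: "a \<in> T \<inter> M" "b \<in> N" "t = a + b"
        by (elim set_plus_elim)
      have "b \<in> T"
        using add_subgroup_diff[OF gri_subgroup[OF gT] t(1), of a] ab by simp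
      then have "b \<in> Y"
        using small[OF N(1)] ab(2) N(2) y by blast
      moreover have "a \<in> Y"
        using small[OF M(1)] M(2) t(1) ab(1) by blast
      ultimately show False
        using t(2) ab(3) add_subgroup_add[OF gri_subgroup[OF Y]] by blast
    qed
  qed
  \<comment> \<open>Modular law: if \<open>Z\<close> is not inside \<open>J\<close>, it is not
    inside \<open>M\<close> either, so \<open>T\<close> is the sum of \<open>Z\<close> and
    \<open>T \<inter> M\<close>. The latter lies in \<open>J\<close> and in the slice, hence already
    in \<open>Z\<close>.\<close>
  have simple: "Z \<subseteq> J \<or> Z = T" if Z: "gri Z" "J \<inter> ?Rf \<subseteq> Z" "Z \<subseteq> T" for Z
  proof (rule disjCI)
    assume "Z \<noteq> T"
    show "Z \<subseteq> J"
    proof (rule ccontr)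
      assume "\<not> Z \<subseteq> J"
      then have "\<not> Z \<subseteq> M"
        using Z(3) TM by blast
      then have sum: "Z + M = UNIV"
        by (rule plus_maximal[OF M(1) Z(1)])
      have "x \<in> Z" if x: "x \<in> T" for x
      proof -
        have "x \<in> Z + M" unfolding sum ..
        then obtain z m where zm: "z \<in> Z" "m \<in> M" "x = z + m"
          by (elim set_plus_elim)
        have "m \<in> T"
          using add_subgroup_diff[OF gri_subgroup[OF gT] x, of z] zm Z(3) by auto
        then have "m \<in> Z"
          using zm(2) TM T Z(2) by blast
        then show ?thesis
          using zm add_subgroup_add[OF gri_subgroup[OF Z(1)]] by blast
      qed
      then show False using \<open>Z \<noteq> T\<close> Z(3) by blast
    qed
  qed
  define S where "S = V + (*) w ` T"
  have gwT: "gri ((*) w ` T)"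
    by (rule gri_translate[OF gT g w(1)])
  have gS: "gri S"
    unfolding S_def by (rule gri_plus[OF V gwT])
  have VS: "V \<subseteq> S" and wTS: "(*) w ` T \<subseteq> S"
    unfolding S_def
    using subset_plus_left[OF gri_subgroup[OF gwT]] subset_plus_right[OF gri_subgroup[OF V]] by auto
  have SX: "\<not> S \<subseteq> X"
    using wTS t unfolding Y_def by blast
  have SW: "S \<subseteq> W"
    unfolding S_def using gri_mult[OF W w(2)]
    by (intro plus_least[OF gri_subgroup[OF W] VW]) blast
  have "covers S V"
    unfolding covers_def
  proof (intro conjI gS V allI impI)
    show "V \<subset> S" using VS SX VX by blast
    fix Z assume Z: "gri Z" "V \<subseteq> Z" "Z \<subseteq> S"
    \<comment> \<open>\<open>Z\<close> is pulled back along \<open>w\<close> to a right ideal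
      between \<open>J \<inter> ?Rf\<close> and \<open>T\<close>, where \<open>simple\<close>
      applies.\<close>
    define Z' where "Z' = T \<inter> {x. w * x \<in> Z}"
    have "gri Z'"
      unfolding Z'_def by (rule gri_Int[OF gT gri_colon[OF Z(1) g w(1)]])
    moreover have "J \<inter> ?Rf \<subseteq> Z'"
      unfolding Z'_def using T WJ[OF w(2)] Z(2) by blast
    ultimately consider "Z' \<subseteq> J" | "Z' = T"
      using simple[of Z'] unfolding Z'_def by blast
    then show "Z = V \<or> Z = S"
    proof cases
      case 1
      have "z \<in> V" if z: "z \<in> Z" for z
      proof -
        have "z \<in> V + (*) w ` T"
          using z Z(3) unfolding S_def by blast
        then obtain v x where vx: "v \<in> V" "x \<in> T" "z = v + w * x"
          by (auto elim!: set_plus_elim)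
        have "w * x \<in> Z"
          using add_subgroup_diff[OF gri_subgroup[OF Z(1)] z, of v] vx Z(2) by auto
        then have "x \<in> J"
          using 1 vx(2) unfolding Z'_def by blast
        then show ?thesis
          using vx WJ[OF w(2)] add_subgroup_add[OF gri_subgroup[OF V]] by blast
      qed
      then show ?thesis using Z(2) by blast
    next
      case 2
      then have "(*) w ` T \<subseteq> Z"
        unfolding Z'_def by blast
      then have "S \<subseteq> Z"
        unfolding S_def by (rule plus_least[OF gri_subgroup[OF Z(1)] Z(2)])
      then show ?thesis using Z(3) by blast
    qed
  qed
  then show ?thesis
    using that SW SX by blast
qed

lemma gri_Union_chain:
  assumes ne: "C \<noteq> {}" and gri: "\<And>U. U \<in> C \<Longrightarrow> gri U"
    and chain: "\<And>U V. U \<in> C \<Longrightarrow> V \<in> C \<Longrightarrow> U \<subseteq> V \<or> V \<subseteq> U"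
  shows "gri (\<Union>C)"
  unfolding graded_iff right_ideal_def add_subgroup_def
proof (intro conjI ballI allI)
  show "0 \<in> \<Union>C"
    using ne gri add_subgroup_zero[OF gri_subgroup] by blast
  fix x assume "x \<in> \<Union>C"
  then obtain U where U: "U \<in> C" "x \<in> U" by blast
  show "- x \<in> \<Union>C"
    using U add_subgroup_uminus[OF gri_subgroup[OF gri]] by blast
  show "x * y \<in> \<Union>C" for y
    using U gri_mult[OF gri] by blast
  show "component x g \<in> \<Union>C" for g
    using U gri_component[OF gri] by blast
  fix y assume "y \<in> \<Union>C"
  then obtain V where V: "V \<in> C" "y \<in> V" by blast
  then obtain N where "N \<in> C" "x \<in> N" "y \<in> N"
    using U chain[OF U(1) V(1)] by blast
  then show "x + y \<in> \<Union>C"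
    using add_subgroup_add[OF gri_subgroup[OF gri]] by blast
qed

text \<open>A graded right ideal that is maximal among those avoiding a given \<open>s \<in> W - V\<close> is a maximal
  subideal of \<open>W\<close>, since \<open>W\<close> is semisimple modulo \<open>V\<close>.\<close>

lemma exists_lower_cover:
  assumes dcc: "\<And>e. e \<in> objs \<Longrightarrow> dcc_at e"
    and V: "gri V" and W: "gri W" and VW: "V \<subset> W"
    and WJ: "\<And>w j. w \<in> W \<Longrightarrow> j \<in> J \<Longrightarrow> w * j \<in> V"
  obtains M where "covers W M"
proof -
  obtain s where s: "s \<in> W" "s \<notin> V"
    using VW by blast
  define A where "A = {U. gri U \<and> V \<subseteq> U \<and> U \<subseteq> W \<and> s \<notin> U}"
  have "\<exists>M\<in>A. \<forall>X\<in>A. M \<subseteq> X \<longrightarrow> X = M"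
  proof (rule subset_Zorn_nonempty)
    show "A \<noteq> {}"
      using V VW s unfolding A_def by blast
    fix C assume "C \<noteq> {}" and C: "subset.chain A C"
    then have CA: "C \<subseteq> A" and tot: "\<And>U V. U \<in> C \<Longrightarrow> V \<in> C \<Longrightarrow> U \<subseteq> V \<or> V \<subseteq> U"
      by (auto simp: subset_chain_def)
    have "gri (\<Union>C)"
      using CA by (intro gri_Union_chain[OF \<open>C \<noteq> {}\<close> _ tot]) (auto simp: A_def)
    then show "\<Union>C \<in> A"
      using CA \<open>C \<noteq> {}\<close> unfolding A_def by blast
  qed
  then obtain M where M: "M \<in> A" and max: "\<And>X. X \<in> A \<Longrightarrow> M \<subseteq> X \<Longrightarrow> X = M"
    by blast
  have gM: "gri M" and VM: "V \<subseteq> M" and MW: "M \<subseteq> W" and sM: "s \<notin> M"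
    using M by (auto simp: A_def)
  have "covers W M"
    unfolding covers_def
  proof (intro conjI W gM allI impI)
    show "M \<subset> W" using MW s sM by blast
    fix Z assume Z: "gri Z" "M \<subseteq> Z" "Z \<subseteq> W"
    show "Z = M \<or> Z = W"
    proof (rule ccontr)
      assume "\<not> (Z = M \<or> Z = W)"
      then have ZM: "Z \<noteq> M" and WZ: "\<not> W \<subseteq> Z"
        using Z(3) by auto
      \<comment> \<open>A graded right ideal strictly above \<open>M\<close> and inside
        \<open>W\<close> must contain \<open>s\<close>. This holds for \<open>Z\<close>, and also
        for \<open>M + S\<close> with \<open>S\<close> a cover of \<open>V\<close> outside
        \<open>Z\<close>. Writing \<open>s = a + b\<close> then forces \<open>b\<close> into
        \<open>Z \<inter> S = V\<close>, so that \<open>s\<close> would lie in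
        \<open>M\<close>.\<close>
      have sZ: "s \<in> Z"
        using ZM max[of Z] Z VM unfolding A_def by blast
      have VZ: "V \<subseteq> Z"
        using VM Z(2) by blast
      obtain S where S: "covers S V" "S \<subseteq> W" "\<not> S \<subseteq> Z"
        using exists_cover_not_in[OF dcc V W Z(1) VZ _ WZ WJ] VW by blast
      have gS: "gri S"
        using S(1) by (simp add: covers_def)
      have "M + S \<noteq> M"
        using S(3) Z(2) subset_plus_right[OF gri_subgroup[OF gM], of S] by blast
      moreover have "M \<subseteq> M + S"
        by (rule subset_plus_left[OF gri_subgroup[OF gS]])
      ultimately have "M + S \<notin> A"
        using max[of "M + S"] by blast
      then have "s \<in> M + S"
        using gri_plus[OF gM gS] VM \<open>M \<subseteq> M + S\<close> plus_least[OF gri_subgroup[OF W] MW S(2)]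
        unfolding A_def by blast
      then obtain a b where ab: "a \<in> M" "b \<in> S" "s = a + b"
        by (elim set_plus_elim)
      have "b \<in> Z"
        using add_subgroup_diff[OF gri_subgroup[OF Z(1)] sZ, of a] ab Z(2) by auto
      moreover have "Z \<inter> S = V"
        using S(1,3) gri_Int[OF Z(1) gS] VZ unfolding covers_def by blast
      ultimately have "b \<in> M"
        using ab(2) VM by blast
      then show False
        using ab sM add_subgroup_add[OF gri_subgroup[OF gM]] by blast
    qed
  qed
  then show ?thesis by (rule that)
qed

section \<open>The ascending chain condition on slices\<close>

definition noeth :: "'a set \<Rightarrow> bool" where
  "noeth W \<longleftrightarrow> (\<forall>X::nat \<Rightarrow> 'a set. (\<forall>i. gri (X i) \<and> X i \<subseteq> X (Suc i) \<and> X i \<subseteq> W) \<longrightarrow>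
    (\<exists>n. \<forall>m\<ge>n. X m = X n))"

lemma noeth_zero: "noeth {0}"
proof -
  have "U = {0}" if "gri U" "U \<subseteq> {0}" for U
    using that add_subgroup_zero[OF gri_subgroup] by blast
  then show ?thesis
    unfolding noeth_def by metis
qed

text \<open>The intersections with \<open>M\<close> become stationary by assumption, and the images
  in the gr-simple quotient \<open>W / M\<close> jump at most once. The modular law combines
  both.\<close>

lemma noeth_cover:
  assumes cov: "covers W M" and M: "noeth M"
  shows "noeth W"
  unfolding noeth_def
proof (intro allI impI)
  fix X :: "nat \<Rightarrow> 'a set" assume "\<forall>i. gri (X i) \<and> X i \<subseteq> X (Suc i) \<and> X i \<subseteq> W"
  then have X: "gri (X i)" "X i \<subseteq> X (Suc i)" "X i \<subseteq> W" for i
    by blast+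
  have gM: "gri M" and gW: "gri W" and MW: "M \<subseteq> W"
    using cov by (auto simp: covers_def)
  have mono: "X i \<subseteq> X j" if "i \<le> j" for i j
    using lift_Suc_mono_le[of X, OF X(2) that] .
  have "\<exists>n. \<forall>m\<ge>n. X m \<inter> M = X n \<inter> M"
    using M[unfolded noeth_def, rule_format, of "\<lambda>i. X i \<inter> M"] X gri_Int[OF X(1) gM] by blast
  then obtain n where n: "\<And>m. m \<ge> n \<Longrightarrow> X m \<inter> M = X n \<inter> M"
    by blast
  show "\<exists>n. \<forall>m\<ge>n. X m = X n"
  proof (cases "\<forall>i. X i \<subseteq> M")
    case True
    then show ?thesis using n by (metis Int_absorb2)
  next
    case False
    then obtain i where i: "\<not> X i \<subseteq> M" by blast
    \<comment> \<open>From index \<open>i\<close> on the chain is no longer inside \<open>M\<close>,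
      and from \<open>n\<close> on its intersection with \<open>M\<close> is constant.\<close>
    define k where "k = max i n"
    have kM: "\<not> X k \<subseteq> M"
      using i mono[of i k] unfolding k_def by auto
    have sum: "X k + M = W"
    proof -
      have "X k + M \<noteq> M"
        using kM subset_plus_left[OF gri_subgroup[OF gM], of "X k"] by blast
      then show ?thesis
        using cov gri_plus[OF X(1)[of k] gM] subset_plus_right[OF gri_subgroup[OF X(1)[of k]], of M]
          plus_least[OF gri_subgroup[OF gW] X(3)[of k] MW] unfolding covers_def by blast
    qed
    have "X m = X k" if m: "m \<ge> k" for m
    proof
      show "X k \<subseteq> X m" using mono[OF m] .
      show "X m \<subseteq> X k"
      proof
        fix x assume x: "x \<in> X m"
        then have "x \<in> X k + M"
          using X(3)[of m] unfolding sum by blast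
        then obtain a b where ab: "a \<in> X k" "b \<in> M" "x = a + b"
          by (elim set_plus_elim)
        have "b \<in> X m"
          using add_subgroup_diff[OF gri_subgroup[OF X(1)[of m]] x, of a] ab mono[OF m] by auto
        moreover have "X m \<inter> M = X k \<inter> M"
          using n[of m] n[of k] m unfolding k_def by auto
        ultimately have "b \<in> X k"
          using ab(2) by blast
        then show "x \<in> X k"
          using ab add_subgroup_add[OF gri_subgroup[OF X(1)]] by blast
      qed
    qed
    then show ?thesis by blast
  qed
qed

lemma noeth_at:
  assumes dcc: "\<And>e. e \<in> objs \<Longrightarrow> dcc_at e" and nil: "nilpotent_ideal J" and e: "e \<in> objs"
  shows "noeth (ideal_at one UNIV e)"
proof (rule ccontr)
  let ?P = "\<lambda>U. gri U \<and> U \<subseteq> ideal_at one UNIV e \<and> \<not> noeth U"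
  assume "\<not> noeth (ideal_at one UNIV e)"
  then have "?P (ideal_at one UNIV e)"
    using gri_at[OF gri_UNIV e] by blast
  then obtain W where W: "?P W" and min: "\<And>Z. ?P Z \<Longrightarrow> Z \<subseteq> W \<Longrightarrow> Z = W"
    using dcc_at_minimal[OF dcc[OF e], of ?P] by blast
  have gW: "gri W" using W by blast
  define V where "V = ideal_mult W J"
  have gV: "gri V"
    unfolding V_def by (rule gri_ideal_mult[OF gW gri_J])
  \<comment> \<open>Nakayama for nilpotent \<open>J\<close>: if \<open>W J\<close> were
    \<open>W\<close>, iteration would express \<open>W\<close> as \<open>W\<close> times a vanishing
    power of \<open>J\<close>, so \<open>W\<close> would be zero and hence noetherian.\<close>
  have "V \<noteq> W"
  proof
    assume "V = W"
    obtain n where n: "n \<ge> 1" "ideal_power J n = {0}"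
      using nil unfolding nilpotent_ideal_def by blast
    have "W = ideal_mult W {0}"
      using ideal_mult_power_stable[OF \<open>V = W\<close>[unfolded V_def] n(1)] n(2) by simp
    also have "\<dots> \<subseteq> {0}"
      by (rule ideal_mult_least[OF gri_subgroup[OF gri_zero]]) simp
    finally have "W = {0}"
      using add_subgroup_zero[OF gri_subgroup[OF gW]] by blast
    then show False using W noeth_zero by blast
  qed
  then have "V \<subset> W"
    using ideal_mult_subset[OF gW, of J] unfolding V_def by blast
  then obtain M where M: "covers W M"
    using exists_lower_cover[OF dcc gV gW] ideal_multI[of _ W _ J] unfolding V_def by metis
  have "gri M" "M \<subset> W"
    using M by (auto simp: covers_def)
  then have "noeth M"
    using min[of M] W by blast
  then show False
    using noeth_cover[OF M] W by blast
qed

section \<open>Gluing slices and transferring chain conditions\<close>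

lemma gri_glue:
  assumes "\<And>e. e \<in> objs \<Longrightarrow> gri (A e)"
  shows "gri {x. \<forall>e\<in>objs. one e * x \<in> A e}"
proof -
  have "gri (\<Inter>e\<in>objs. {x. one e * x \<in> A e})"
  proof (rule gri_Inter)
    fix B assume "B \<in> (\<lambda>e. {x. one e * x \<in> A e}) ` objs"
    then obtain e where "e \<in> objs" "B = {x. one e * x \<in> A e}"
      by blast
    then show "gri B"
      using gri_colon[OF assms objs_closed one_in] by blast
  qed
  moreover have "(\<Inter>e\<in>objs. {x. one e * x \<in> A e}) = {x. \<forall>e\<in>objs. one e * x \<in> A e}"
    by blast
  ultimately show ?thesis by simp
qed

text \<open>An \<open>x\<close> fixed by \<open>one e\<close> is annihilated by every other
  \<open>one f\<close>, so the glued ideal constrains it only at \<open>e\<close>. Slices can thus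
  be prescribed independently.\<close>

lemma at_glue:
  assumes A: "\<And>e. e \<in> objs \<Longrightarrow> gri (A e)" and e: "e \<in> objs"
  shows "ideal_at one {x. \<forall>e\<in>objs. one e * x \<in> A e} e = ideal_at one (A e) e"
    (is "ideal_at one ?G e = _")
proof (intro set_eqI)
  fix x
  have "x \<in> ?G \<longleftrightarrow> x \<in> A e" if x: "one e * x = x"
  proof -
    have "one f * x = (if f = e then x else 0)" if "f \<in> objs" for f
      using one_one_mult[OF e that, of x] x by simp
    then show ?thesis
      using e add_subgroup_zero[OF gri_subgroup[OF A]] by auto
  qed
  then show "x \<in> ideal_at one ?G e \<longleftrightarrow> x \<in> ideal_at one (A e) e"
    using mem_at[OF gri_glue[of A, OF A] e, of x] mem_at[OF A[OF e] e, of x] by blast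
qed

text \<open>\<open>N e\<close> is the first index from which the slices at \<open>e\<close> are
  constant. For an object it exists by the ascending chain condition on the slice, and a common
  bound \<open>k\<close> would give \<open>U k = U (Suc k)\<close> by
  \<open>eq_if_at\<close>.\<close>

lemma stabilization_index:
  assumes noeth: "\<And>e. e \<in> objs \<Longrightarrow> noeth (ideal_at one UNIV e)"
    and gri: "\<And>i. gri (U i)" and strict: "\<And>i. U i \<subset> U (Suc i)"
  obtains N :: "'g \<Rightarrow> nat" where
    "\<And>e n. \<forall>m\<ge>n. ideal_at one (U m) e = ideal_at one (U n) e \<Longrightarrow> N e \<le> n"
    and "\<And>k. \<exists>e\<in>objs. k < N e"
proof -
  let ?Q = "\<lambda>e n. \<forall>m\<ge>n. ideal_at one (U m) e = ideal_at one (U n) e"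
  define N where "N e = (LEAST n. ?Q e n)" for e
  have "\<exists>n. ?Q e n" if e: "e \<in> objs" for e
  proof -
    have "U i \<subseteq> U (Suc i)" for i
      using strict[of i] by blast
    then have "\<forall>i. gri (ideal_at one (U i) e) \<and> ideal_at one (U i) e \<subseteq> ideal_at one (U (Suc i)) e
      \<and> ideal_at one (U i) e \<subseteq> ideal_at one UNIV e"
      using gri_at[OF gri e] by (simp add: at_mono)
    then show ?thesis
      using noeth[OF e, unfolded noeth_def, THEN spec[of _ "\<lambda>i. ideal_at one (U i) e"]] by (rule rev_mp)
  qed
  then have N: "?Q e (N e)" if "e \<in> objs" for e
    unfolding N_def by (rule LeastI_ex) (use that in simp)
  have least: "N e \<le> n" if "?Q e n" for e n
    unfolding N_def by (rule Least_le) (rule that)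
  have unbounded: "\<exists>e\<in>objs. k < N e" for k
  proof (rule ccontr)
    assume "\<not> (\<exists>e\<in>objs. k < N e)"
    then have le: "N e \<le> k" if "e \<in> objs" for e
      using that by (meson not_less)
    have "ideal_at one (U k) e = ideal_at one (U (Suc k)) e" if e: "e \<in> objs" for e
      using N[OF e, rule_format, OF le[OF e]] N[OF e, rule_format, OF le_SucI[OF le[OF e]]] by simp
    then have "U k = U (Suc k)"
      by (rule eq_if_at[OF gri gri])
    then show False
      using strict[of k] by simp
  qed
  show ?thesis
    by (rule that[OF least unbounded])
qed

text \<open>Reading the chain \<open>U\<close> backwards from its stabilization index at each \<open>e\<close> separately turns
  a forbidden ascending chain into a forbidden descending one.\<close>

lemma strongly_noetherian_if_strongly_artinian:
  assumes art: "right_strongly_artinian \<Gamma> d R one"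
    and noeth: "\<And>e. e \<in> objs \<Longrightarrow> noeth (ideal_at one UNIV e)"
  shows "right_strongly_noetherian \<Gamma> d R one"
  unfolding right_strongly_noetherian_def
proof
  assume "\<exists>U::nat \<Rightarrow> 'a set. (\<forall>i. gri (U i)) \<and> (\<forall>i. U i \<subset> U (Suc i))
      \<and> stops_at_repetition objs one U"
  then obtain U :: "nat \<Rightarrow> 'a set" where U: "\<And>i. gri (U i)" "\<And>i. U i \<subset> U (Suc i)"
    and stops: "stops_at_repetition objs one U"
    by blast
  obtain N :: "'g \<Rightarrow> nat" where
    least: "\<And>e n. \<forall>m\<ge>n. ideal_at one (U m) e = ideal_at one (U n) e \<Longrightarrow> N e \<le> n"
    and unbounded: "\<And>k. \<exists>e\<in>objs. k < N e"
    using stabilization_index[where U = U, OF noeth U] by blast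
  have mono: "U i \<subseteq> U j" if "i \<le> j" for i j
    using lift_Suc_mono_le[of U, OF _ that] U(2) by blast
  \<comment> \<open>The stopping condition would turn a repetition before \<open>N e\<close> into a
    constant tail, against the minimality of \<open>N e\<close>.\<close>
  have neq: "ideal_at one (U i) e \<noteq> ideal_at one (U (Suc i)) e" if e: "e \<in> objs" "i < N e" for e i
  proof
    assume "ideal_at one (U i) e = ideal_at one (U (Suc i)) e"
    then have eq: "ideal_at one (U i) e = ideal_at one (U (i + l)) e" if "l \<ge> 1" for l
      using stops e(1) that unfolding stops_at_repetition_def by blast
    have "\<forall>m\<ge>i. ideal_at one (U m) e = ideal_at one (U i) e"
    proof (intro allI impI)
      fix m assume "i \<le> m"
      then show "ideal_at one (U m) e = ideal_at one (U i) e"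
        using eq[of "m - i"] by (cases "m = i") simp_all
    qed
    then have "N e \<le> i"
      by (rule least)
    then show False
      using e(2) by simp
  qed
  \<comment> \<open>Subtraction on the naturals is truncated: once \<open>i\<close> reaches
    \<open>N e\<close>, the slice at \<open>e\<close> stays that of \<open>U 0\<close>.\<close>
  define V where "V i = {x. \<forall>e\<in>objs. one e * x \<in> U (N e - i)}" for i
  have gV: "gri (V i)" for i
    unfolding V_def by (rule gri_glue[OF U(1)])
  have at_V: "ideal_at one (V i) e = ideal_at one (U (N e - i)) e" if "e \<in> objs" for i e
    unfolding V_def using at_glue[of "\<lambda>e. U (N e - i)", OF U(1) that] .
  have neqV: "ideal_at one (V i) e \<noteq> ideal_at one (V (Suc i)) e" if e: "e \<in> objs" "i < N e" for e i
  proof -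
    \<comment> \<open>The step of \<open>V\<close> from \<open>i\<close> to \<open>Suc i\<close> at
      \<open>e\<close> is the step of \<open>U\<close> from \<open>N e - Suc i\<close> to
      \<open>N e - i\<close>, read backwards.\<close>
    have "Suc (N e - Suc i) = N e - i"
      using e(2) by simp
    then show ?thesis
      using neq[OF e(1), of "N e - Suc i"] e by (simp add: at_V)
  qed
  have "V (Suc i) \<subset> V i" for i
  proof -
    have "V (Suc i) \<subseteq> V i"
    proof -
      have "U (N e - Suc i) \<subseteq> U (N e - i)" for e
        by (rule mono) simp
      then show ?thesis
        unfolding V_def by blast
    qed
    moreover have "V (Suc i) \<noteq> V i"
      using unbounded[of i] neqV by metis
    ultimately show ?thesis by blast
  qed
  moreover have "stops_at_repetition objs one V"
    unfolding stops_at_repetition_def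
  proof (intro ballI allI impI)
    fix e i l assume e: "e \<in> objs" and "ideal_at one (V i) e = ideal_at one (V (Suc i)) e"
    then have "N e \<le> i"
      using neqV[OF e, of i] by (meson not_less)
    then show "ideal_at one (V i) e = ideal_at one (V (i + l)) e"
      by (simp add: at_V[OF e])
  qed
  ultimately show False
    using art gV unfolding right_strongly_artinian_def by blast
qed

text \<open>\<open>V i\<close> collects the slices \<open>1_e R\<close> with \<open>i < N e\<close>.
  A minimal member \<open>V k\<close> and an object with \<open>k < N e\<close> give
  \<open>V (N e) = V k\<close>, but the slices of these at \<open>e\<close> are zero and
  \<open>1_e R\<close>. So \<open>1_e R\<close> vanishes, and \<open>U\<close> is constant at
  \<open>e\<close> from index 0 on, which contradicts \<open>k < N e\<close>.\<close>

lemma noetherian_if_artinian: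
  assumes art: "right_gr_artinian \<Gamma> R"
    and noeth: "\<And>e. e \<in> objs \<Longrightarrow> noeth (ideal_at one UNIV e)"
  shows "right_gr_noetherian \<Gamma> R"
  unfolding right_gr_noetherian_def
proof
  assume "\<exists>U::nat \<Rightarrow> 'a set. (\<forall>i. gri (U i)) \<and> (\<forall>i. U i \<subset> U (Suc i))"
  then obtain U :: "nat \<Rightarrow> 'a set" where U: "\<And>i. gri (U i)" "\<And>i. U i \<subset> U (Suc i)"
    by blast
  obtain N :: "'g \<Rightarrow> nat" where
    least: "\<And>e n. \<forall>m\<ge>n. ideal_at one (U m) e = ideal_at one (U n) e \<Longrightarrow> N e \<le> n"
    and unbounded: "\<And>k. \<exists>e\<in>objs. k < N e"
    using stabilization_index[where U = U, OF noeth U] by blast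
  define A where "A i e = (if N e \<le> i then {0} else UNIV :: 'a set)" for i :: nat and e
  have gA: "gri (A i e)" for i e
    by (simp add: A_def gri_zero gri_UNIV)
  define V where "V i = {x. \<forall>e\<in>objs. one e * x \<in> A i e}" for i
  have gV: "gri (V i)" for i
    unfolding V_def by (rule gri_glue[OF gA])
  \<comment> \<open>\<open>V\<close> may have repetitions and need not be a strict chain;
    well-foundedness supplies a minimal member \<open>V k\<close> instead.\<close>
  have "wf {(X, Y). gri X \<and> gri Y \<and> X \<subset> Y}"
    unfolding wf_iff_no_infinite_down_chain
  proof
    assume "\<exists>X. \<forall>i. (X (Suc i), X i) \<in> {(X, Y). gri X \<and> gri Y \<and> X \<subset> Y}"
    then obtain X where "\<forall>i. (X (Suc i), X i) \<in> {(X, Y). gri X \<and> gri Y \<and> X \<subset> Y}"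
      by (rule exE)
    then have "\<forall>i. gri (X i)" "\<forall>i. X (Suc i) \<subset> X i"
      by simp_all
    then show False
      using art unfolding right_gr_artinian_def by blast
  qed
  moreover have "V 0 \<in> range V"
    by simp
  ultimately obtain k where k: "\<And>i. \<not> V i \<subset> V k"
  proof (rule wfE_min)
    fix Z assume "Z \<in> range V"
      and min: "\<And>Y. (Y, Z) \<in> {(X, Y). gri X \<and> gri Y \<and> X \<subset> Y} \<Longrightarrow> Y \<notin> range V"
    then obtain k where "Z = V k"
      by blast
    then have "\<not> V i \<subset> V k" for i
      using min[of "V i"] gV by auto
    then show thesis
      by (rule that)
  qed
  obtain e where e: "e \<in> objs" "k < N e"
    using unbounded by blast
  have "V (N e) \<subseteq> V k"
  proof
    fix x assume "x \<in> V (N e)"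
    then have x: "one f * x \<in> A (N e) f" if "f \<in> objs" for f
      using that by (simp add: V_def)
    have "one f * x \<in> A k f" if "f \<in> objs" for f
      using x[OF that] e(2) by (simp add: A_def split: if_splits)
    then show "x \<in> V k"
      by (simp add: V_def)
  qed
  then have "V (N e) = V k"
    using k by blast
  then have "ideal_at one (A (N e) e) e = ideal_at one (A k e) e"
    using at_glue[of "A (N e)", OF gA e(1)] at_glue[of "A k", OF gA e(1)] by (simp add: V_def)
  then have 0: "ideal_at one UNIV e \<subseteq> {0}"
    using e(2) by (auto simp: A_def ideal_at_def)
  have "ideal_at one (U m) e = {0}" for m
    using at_mono[of "U m" UNIV e] 0 add_subgroup_zero[OF gri_subgroup[OF gri_at[OF U(1)[of m] e(1)]]]
    by blast
  then have "N e \<le> 0"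
    by (intro least) simp
  then show False
    using e(2) by simp
qed

end

theorem corollary5p13:
  fixes \<Gamma> :: "'g set" and mlt :: "'g \<Rightarrow> 'g \<Rightarrow> 'g" and d r :: "'g \<Rightarrow> 'g"
    and R :: "'g \<Rightarrow> 'a::ring set" and one :: "'g \<Rightarrow> 'a"
  assumes "graded_ring \<Gamma> mlt d r R one"
  shows "(right_strongly_artinian \<Gamma> d R one \<longrightarrow>
            nilpotent_ideal (gr_rad \<Gamma> R) \<and> right_strongly_noetherian \<Gamma> d R one)
       \<and> (right_gr_artinian \<Gamma> R \<longrightarrow>
            nilpotent_ideal (gr_rad \<Gamma> R) \<and> right_gr_noetherian \<Gamma> R)"
proof -
  interpret graded_ring \<Gamma> mlt d r R one by fact
  \<comment> \<open>A right gr-artinian ring is right strongly artinian, so nilpotency and the chain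
    condition on slices serve both parts.\<close>
  have "noeth (ideal_at one UNIV e)" if "right_strongly_artinian \<Gamma> d R one" "e \<in> objs" for e
    using that by (intro noeth_at dcc_at_if_strongly_artinian nilpotent_J)
  then show ?thesis
    using nilpotent_J strongly_noetherian_if_strongly_artinian noetherian_if_artinian
      strongly_artinian_if_artinian by blast
qed

end
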